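(* Let $(X,T,\mathcal{A},\mu)$ be a conservative ergodic measure preserving dynamical system, where $\mu$ is an infinite $\sigma$-finite measure. Let $A\in\mathcal{A}$ with $0<\mu(A)<\infty$ be a uniformly returning set. If the wandering rate $(W_n)=(W_n(A))$ is slowly varying, then $$\Lambda_n\stackrel{\mathcal{L}(\mu)}{\Longrightarrow}\boldsymbol{U}\qquad\text{and}\qquad\Delta_n\stackrel{\mathcal{L}(\mu)}{\Longrightarrow}\boldsymbol{U},$$ where $\boldsymbol{U}$ denotes a random variable uniformly distributed on the unit interval $[0,1]$.
   Context: $\mathcal{P}_\mu$ is the set of probability measures $\nu$ on $\mathcal{A}$ with $\nu\ll\mu$; the same symbol also denotes the set of the corresponding densities with respect to $\mu$. Transfer operator: $\hat T:L_1(\mu)\to L_1(\mu)$ is the positive linear operator characterized by $\int_B\hat T(f)\,d\mu=\int_{T^{-1}(B)}f\,d\mu$ for all $f\in L_1(\mu)$, $B\in\mathcal{A}$. Uniformly returning sets: a set $A\in\mathcal{A}$ with $0<\mu(A)<\infty$ is uniformly returning for $f\in\mathcal{P}_\mu$ if there is a positive increasing sequence $(b_n)$ such that $b_n\hat T^n(f)\to1$ $\mu$-a.e. uniformly on $A$ (i.e. in $L_\infty(\mu|_A)$). $A$ is uniformly returning if it is uniformly returning for some $f\in\mathcal{P}_\mu$. For fixed $A$: $A_n:=\bigcup_{k=0}^nT^{-k}A$; the first return time is $\varphi(x)=\inf\{n\ge1:T^n(x)\in A\}$, $x\in X$; the wandering rate is $W_n=W_n(A):=\mu(A_n)=\sum_{k=0}^n\mu(A\cap\{\varphi>k\})$,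 $n\ge0$. Processes: $Z_n(x):=\max\{k\le n:T^k(x)\in A\}$ (with $k\geq 0$) if $x\in A_n$ and $Z_n(x):=0$ otherwise; $Y_n(x):=\min\{k>n:T^k(x)\in A\}$; $V_n:=Y_n-Z_n$. (By conservativity and ergodicity $Y_n<\infty$ $\mu$-a.e.) Moreover $$\Lambda_n:=\frac{\sum_{k=0}^{V_n}\mu(A\cap\{\varphi>k\})}{\mu(A_n)},\qquad\Delta_n:=\frac{\sum_{k=0}^{Y_n-n}\mu(A\cap\{\varphi>k\})}{\mu(A_n)}.$$ Strong distributional convergence: $R_n\stackrel{\mathcal{L}(\mu)}{\Longrightarrow}R$ means that for every $\nu\in\mathcal{P}_\mu$, $R_n$ converges in distribution to $R$ with respect to $\nu$. Slow variation: a measurable $L:\mathbb{R}^+\to\mathbb{R}$ with $L>0$ on some $(a,\infty)$, $a>0$, is slowly varying (at $\infty$) if $\lim_{t\to\infty}L(\lambda t)/L(t)=1$ for all $\lambda>0$; a sequence $(u_n)$ is slowly varying if $u_n=L(n)$, $n\ge1$, for such an $L$. *)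

theory Defs
  imports "HOL-Probability.Probability"
begin

definition measure_preserving :: "'a measure \<Rightarrow> ('a \<Rightarrow> 'a) \<Rightarrow> bool" where
  "measure_preserving M T \<longleftrightarrow> T \<in> measurable M M \<and>
     (\<forall>B\<in>sets M. emeasure M (T -` B \<inter> space M) = emeasure M B)"

definition pre_iter :: "'a measure \<Rightarrow> ('a \<Rightarrow> 'a) \<Rightarrow> nat \<Rightarrow> 'a set \<Rightarrow> 'a set" where
  "pre_iter M T k B = (T ^^ k) -` B \<inter> space M"

definition wandering_set :: "'a measure \<Rightarrow> ('a \<Rightarrow> 'a) \<Rightarrow> 'a set \<Rightarrow> bool" where
  "wandering_set M T W \<longleftrightarrow> W \<in> sets M \<and> disjoint_family (\<lambda>k. pre_iter M T k W)"

definition conservative :: "'a measure \<Rightarrow> ('a \<Rightarrow> 'a) \<Rightarrow> bool" where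
  "conservative M T \<longleftrightarrow> (\<forall>W. wandering_set M T W \<longrightarrow> emeasure M W = 0)"

definition ergodic :: "'a measure \<Rightarrow> ('a \<Rightarrow> 'a) \<Rightarrow> bool" where
  "ergodic M T \<longleftrightarrow> (\<forall>B\<in>sets M. T -` B \<inter> space M = B \<longrightarrow>
     emeasure M B = 0 \<or> emeasure M (space M - B) = 0)"

definition ac_prob_measures :: "'a measure \<Rightarrow> 'a measure set" where
  "ac_prob_measures M = {\<nu>. prob_space \<nu> \<and> sets \<nu> = sets M \<and> absolutely_continuous M \<nu>}"

definition ac_prob_densities :: "'a measure \<Rightarrow> ('a \<Rightarrow> real) set" where
  "ac_prob_densities M = {f. integrable M f \<and> (AE x in M. 0 \<le> f x) \<and> (\<integral>x. f x \<partial>M) = 1}"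

definition is_transfer :: "'a measure \<Rightarrow> ('a \<Rightarrow> 'a) \<Rightarrow> ('a \<Rightarrow> real) \<Rightarrow> ('a \<Rightarrow> real) \<Rightarrow> bool" where
  "is_transfer M T f g \<longleftrightarrow> integrable M g \<and>
     (\<forall>B\<in>sets M. set_lebesgue_integral M B g = set_lebesgue_integral M (T -` B \<inter> space M) f)"

(* Elements of L1 are represented by integrable functions, so the operator picks some
   representative of the image class. For integrable f such a representative exists and is
   unique almost everywhere: see is_transfer_ex and is_transfer_AE_unique below. *)
definition transfer_op :: "'a measure \<Rightarrow> ('a \<Rightarrow> 'a) \<Rightarrow> ('a \<Rightarrow> real) \<Rightarrow> ('a \<Rightarrow> real)" where
  "transfer_op M T f = (SOME g. is_transfer M T f g)"

(* Convergence in L_infinity of the restriction of M to A, i.e. uniform convergence on A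
   off a null set. *)
definition AE_uniform_limit_on ::
    "'a measure \<Rightarrow> 'a set \<Rightarrow> (nat \<Rightarrow> 'a \<Rightarrow> real) \<Rightarrow> ('a \<Rightarrow> real) \<Rightarrow> bool" where
  "AE_uniform_limit_on M A g h \<longleftrightarrow> (\<exists>N\<in>null_sets M. uniform_limit (A - N) g h sequentially)"

definition uniformly_returning_for ::
    "'a measure \<Rightarrow> ('a \<Rightarrow> 'a) \<Rightarrow> 'a set \<Rightarrow> ('a \<Rightarrow> real) \<Rightarrow> bool" where
  "uniformly_returning_for M T A f \<longleftrightarrow>
     A \<in> sets M \<and> 0 < emeasure M A \<and> emeasure M A < \<infinity> \<and> f \<in> ac_prob_densities M \<and>
     (\<exists>b::nat \<Rightarrow> real. (\<forall>n. 0 < b n) \<and> incseq b \<and>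
        AE_uniform_limit_on M A (\<lambda>n x. b n * (transfer_op M T ^^ n) f x) (\<lambda>_. 1))"

definition uniformly_returning :: "'a measure \<Rightarrow> ('a \<Rightarrow> 'a) \<Rightarrow> 'a set \<Rightarrow> bool" where
  "uniformly_returning M T A \<longleftrightarrow> (\<exists>f. uniformly_returning_for M T A f)"

definition hit_set :: "'a measure \<Rightarrow> ('a \<Rightarrow> 'a) \<Rightarrow> 'a set \<Rightarrow> nat \<Rightarrow> 'a set" where
  "hit_set M T A n = (\<Union>k\<le>n. pre_iter M T k A)"

definition wandering_rate :: "'a measure \<Rightarrow> ('a \<Rightarrow> 'a) \<Rightarrow> 'a set \<Rightarrow> nat \<Rightarrow> real" where
  "wandering_rate M T A n = measure M (hit_set M T A n)"

(* Extended naturals: the infimum is infinite if the orbit never returns to A. *)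
definition return_time :: "('a \<Rightarrow> 'a) \<Rightarrow> 'a set \<Rightarrow> 'a \<Rightarrow> enat" where
  "return_time T A x = (INF n\<in>{n. 1 \<le> n \<and> (T ^^ n) x \<in> A}. enat n)"

definition return_tail :: "'a measure \<Rightarrow> ('a \<Rightarrow> 'a) \<Rightarrow> 'a set \<Rightarrow> nat \<Rightarrow> real" where
  "return_tail M T A k = measure M (A \<inter> {x. return_time T A x > enat k})"

definition Z_proc :: "'a measure \<Rightarrow> ('a \<Rightarrow> 'a) \<Rightarrow> 'a set \<Rightarrow> nat \<Rightarrow> 'a \<Rightarrow> nat" where
  "Z_proc M T A n x = (if x \<in> hit_set M T A n then Max {k. k \<le> n \<and> (T ^^ k) x \<in> A} else 0)"

(* If the orbit of x never visits A after time n (a null set of x in the conservative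
   ergodic case), this is a fixed arbitrary value; only then can the natural-number
   subtractions below truncate. *)
definition Y_proc :: "('a \<Rightarrow> 'a) \<Rightarrow> 'a set \<Rightarrow> nat \<Rightarrow> 'a \<Rightarrow> nat" where
  "Y_proc T A n x = (LEAST k. n < k \<and> (T ^^ k) x \<in> A)"

definition V_proc :: "'a measure \<Rightarrow> ('a \<Rightarrow> 'a) \<Rightarrow> 'a set \<Rightarrow> nat \<Rightarrow> 'a \<Rightarrow> nat" where
  "V_proc M T A n x = Y_proc T A n x - Z_proc M T A n x"

definition Lambda_proc :: "'a measure \<Rightarrow> ('a \<Rightarrow> 'a) \<Rightarrow> 'a set \<Rightarrow> nat \<Rightarrow> 'a \<Rightarrow> real" where
  "Lambda_proc M T A n x =
     (\<Sum>k=0..V_proc M T A n x. return_tail M T A k) / measure M (hit_set M T A n)"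

definition Delta_proc :: "'a measure \<Rightarrow> ('a \<Rightarrow> 'a) \<Rightarrow> 'a set \<Rightarrow> nat \<Rightarrow> 'a \<Rightarrow> real" where
  "Delta_proc M T A n x =
     (\<Sum>k=0..Y_proc T A n x - n. return_tail M T A k) / measure M (hit_set M T A n)"

(* The limit enters only through its law. Measurability of the R n is part of the notion,
   since distr is meaningless for non-measurable functions. *)
definition strong_dist_conv :: "'a measure \<Rightarrow> (nat \<Rightarrow> 'a \<Rightarrow> real) \<Rightarrow> real measure \<Rightarrow> bool" where
  "strong_dist_conv M R law \<longleftrightarrow> (\<forall>n. R n \<in> borel_measurable M) \<and>
     (\<forall>\<nu>\<in>ac_prob_measures M. weak_conv_m (\<lambda>n. distr \<nu> borel (R n)) law)"

definition slowly_varying :: "(real \<Rightarrow> real) \<Rightarrow> bool" where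
  "slowly_varying L \<longleftrightarrow> L \<in> borel_measurable (restrict_space borel {0<..}) \<and>
     (\<exists>a>0. \<forall>t>a. L t > 0) \<and>
     (\<forall>c>0. ((\<lambda>t. L (c * t) / L t) \<longlongrightarrow> 1) at_top)"

definition slowly_varying_seq :: "(nat \<Rightarrow> real) \<Rightarrow> bool" where
  "slowly_varying_seq u \<longleftrightarrow> (\<exists>L. slowly_varying L \<and> (\<forall>n\<ge>1. u n = L (real n)))"

lemma is_transfer_AE_unique:
  assumes "is_transfer M T f g" "is_transfer M T f h"
  shows "AE x in M. g x = h x"
  using assms unfolding is_transfer_def
  by (intro density_unique_real) auto

lemma is_transfer_ex_nonneg:
  assumes "sigma_finite_measure M" "measure_preserving M T" "integrable M f"
    and nn: "\<And>x. 0 \<le> f x"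
  shows "\<exists>g. is_transfer M T f g"
proof -
  interpret sigma_finite_measure M by fact
  have T[measurable]: "T \<in> measurable M M" 
    and mp: "\<And>B. B \<in> sets M \<Longrightarrow> emeasure M (T -` B \<inter> space M) = emeasure M B"
    using assms(2) by (auto simp: measure_preserving_def)
  have f[measurable]: "f \<in> borel_measurable M" using assms(3) by auto
  define N where "N = distr (density M f) M T"
  have em: "emeasure N B = ennreal (\<integral>x\<in>T -` B \<inter> space M. f x \<partial>M)" if B[measurable]: "B \<in> sets M" for B
  proof -
    have m[measurable]: "T -` B \<inter> space M \<in> sets M" by measurable
    have "emeasure N B = (\<integral>\<^sup>+x\<in>T -` B \<inter> space M. f x \<partial>M)"
      unfolding N_def by (subst emeasure_distr) (auto simp: emeasure_density)
    also have "\<dots> = (\<integral>\<^sup>+x. ennreal (indicator (T -` B \<inter> space M) x *\<^sub>R f x) \<partial>M)"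
      by (intro nn_integral_cong) (auto split: split_indicator)
    also have "\<dots> = ennreal (\<integral>x\<in>T -` B \<inter> space M. f x \<partial>M)"
      unfolding set_lebesgue_integral_def
      using integrable_mult_indicator[OF m assms(3)] nn
      by (intro nn_integral_eq_integral) (auto split: split_indicator)
    finally show ?thesis .
  qed
  have sN: "sets N = sets M" "space N = space M" by (auto simp: N_def)
  have fin: "finite_measure N"
    by (rule finite_measureI) (use em[of "space M"] sN in auto)
  have ac: "absolutely_continuous M N"
    unfolding absolutely_continuous_def
  proof safe
    fix B assume B: "B \<in> null_sets M"
    then have "T -` B \<inter> space M \<in> null_sets M" using mp[of B] by (auto simp: null_sets_def)
    then have "(\<integral>x\<in>T -` B \<inter> space M. f x \<partial>M) = 0"
      unfolding set_lebesgue_integral_def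
      using AE_not_in[OF \<open>T -` B \<inter> space M \<in> null_sets M\<close>]
      by (intro integral_eq_zero_AE) (auto elim!: eventually_mono simp: indicator_def)
    then show "B \<in> null_sets N" using em[of B] B sN by (auto simp: null_sets_def)
  qed
  obtain D where D[measurable]: "D \<in> borel_measurable M"
    and D1: "AE x in M. RN_deriv M N x = ennreal (D x)" and D0: "\<And>x. 0 \<le> D x"
    using real_RN_deriv[OF fin ac] sN by metis
  have NB: "(\<integral>\<^sup>+x. ennreal (indicator B x *\<^sub>R D x) \<partial>M) = emeasure N B" if B[measurable]: "B \<in> sets M" for B
  proof -
    have "emeasure N B = emeasure (density M (RN_deriv M N)) B"
      using density_RN_deriv[OF ac] sN by simp
    also have "\<dots> = (\<integral>\<^sup>+x. RN_deriv M N x * indicator B x \<partial>M)"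
      by (subst emeasure_density) auto
    also have "\<dots> = (\<integral>\<^sup>+x. ennreal (indicator B x *\<^sub>R D x) \<partial>M)"
      using D1 by (intro nn_integral_cong_AE) (auto elim!: eventually_mono split: split_indicator)
    finally show ?thesis by simp
  qed
  have "(\<integral>\<^sup>+x. ennreal (D x) \<partial>M) = emeasure N (space M)"
    using NB[of "space M"] by (auto cong: nn_integral_cong simp: indicator_def)
  then have iD: "integrable M D"
    using fin sN D0 by (intro integrableI_nonneg) (auto simp: finite_measure.finite_emeasure_space em less_top[symmetric])
  have "is_transfer M T f D"
    unfolding is_transfer_def
  proof (intro conjI ballI iD)
    fix B assume B[measurable]: "B \<in> sets M"
    have "ennreal (\<integral>x\<in>B. D x \<partial>M) = (\<integral>\<^sup>+x. ennreal (indicator B x *\<^sub>R D x) \<partial>M)"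
      unfolding set_lebesgue_integral_def
      using integrable_mult_indicator[OF B iD] D0
      by (intro nn_integral_eq_integral[symmetric]) (auto split: split_indicator)
    also have "\<dots> = ennreal (\<integral>x\<in>T -` B \<inter> space M. f x \<partial>M)"
      using NB[OF B] em[OF B] by simp
    finally show "(\<integral>x\<in>B. D x \<partial>M) = (\<integral>x\<in>T -` B \<inter> space M. f x \<partial>M)"
      using D0 nn unfolding set_lebesgue_integral_def
      by (subst (asm) ennreal_inj) (auto intro!: integral_nonneg_AE split: split_indicator)
  qed
  then show ?thesis by blast
qed

lemma is_transfer_ex:
  assumes "sigma_finite_measure M" "measure_preserving M T" "integrable M f"
  shows "\<exists>g. is_transfer M T f g"
proof -
  have T[measurable]: "T \<in> measurable M M" 
    using assms(2) by (auto simp: measure_preserving_def)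
  have i: "integrable M (\<lambda>x. max 0 (f x))" "integrable M (\<lambda>x. max 0 (- f x))"
    using assms(3) by auto
  obtain g h where gh: "is_transfer M T (\<lambda>x. max 0 (f x)) g" "is_transfer M T (\<lambda>x. max 0 (- f x)) h"
    using is_transfer_ex_nonneg[OF assms(1,2) i(1)] is_transfer_ex_nonneg[OF assms(1,2) i(2)] by auto
  have si: "set_integrable M B u" if "integrable M u" "B \<in> sets M" for B and u :: "'a \<Rightarrow> real"
    unfolding set_integrable_def using that by (intro integrable_mult_indicator)
  have f: "f = (\<lambda>x. max 0 (f x) - max 0 (- f x))" by (auto simp: fun_eq_iff)
  have "is_transfer M T (\<lambda>x. max 0 (f x) - max 0 (- f x)) (\<lambda>x. g x - h x)"
    using gh i unfolding is_transfer_def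
    by (auto simp: si set_integral_diff measurable_sets[OF T])
  then show ?thesis using f by metis
qed

lemma is_transfer_transfer_op:
  assumes "sigma_finite_measure M" "measure_preserving M T" "integrable M f"
  shows "is_transfer M T f (transfer_op M T f)"
  unfolding transfer_op_def using is_transfer_ex[OF assms] by (rule someI_ex)

end

theory Submission
  imports Defs
begin

text \<open>Let \<open>\<nu>\<close> have density \<open>f\<close>, put \<open>w j = W\<^sub>j\<^sub>-\<^sub>1\<close>, and decompose a visit to \<open>A\<close> during
  \<open>(m - j, m]\<close> according to its last visit time. Under \<open>M\<close> this event has measure \<open>w j\<close>; under
  \<open>\<nu>\<close> its probability is, by uniform return, up to a factor near 1 between \<open>w j / b m\<close> and
  \<open>w j / b (m + 1 - j)\<close>. Taking \<open>j\<close> close to \<open>m\<close>, where the probability tends to 1, and using slow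
  variation gives \<open>b n \<sim> w n\<close>, so the probability tends to \<open>t\<close> whenever \<open>w j / w m\<close> tends to
  \<open>t\<close>. These events are asymptotically invariant under \<open>T\<close>, so by ergodicity the same limit holds
  for every probability absolutely continuous with respect to \<open>M\<close>. Finally \<open>\<Delta>\<^sub>n \<le> t\<close> says that
  there is a visit during \<open>(n, n + j)\<close> with \<open>w j \<sim> t w n\<close>. Since \<open>\<Delta>\<^sub>n \<le> \<Lambda>\<^sub>n\<close>, it remains to
  bound \<open>\<Lambda>\<^sub>n\<close> above: visits during both \<open>(n - j, n]\<close> and \<open>(n, n + j]\<close> force
  \<open>V\<^sub>n < 2 j\<close>, and \<open>w (2 j) \<sim> w j\<close> makes the visits during the two intervals asymptotically the
  same event.\<close>

section \<open>Asymptotically invariant events\<close>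

lemma (in prob_space) integral_bounded01:
  fixes u :: "'a \<Rightarrow> real"
  assumes [measurable]: "u \<in> borel_measurable M" and "\<And>x. 0 \<le> u x \<and> u x \<le> 1"
  shows "integrable M u"
  by (rule integrable_const_bound[where B=1]) (use assms in auto)

text \<open>Near minimizers of the squared \<open>L\<^sup>2\<close>-norm over nested convex sets are Cauchy, by the
  parallelogram law; their limit replaces a weak limit point of the sequence of events.\<close>

lemma nested_convex_L1_Cauchy:
  fixes K :: "nat \<Rightarrow> ('a \<Rightarrow> real) set"
  assumes "prob_space P"
    and ne: "\<And>n. K n \<noteq> {}"
    and dec: "decseq K"
    and mid: "\<And>n u v. u \<in> K n \<Longrightarrow> v \<in> K n \<Longrightarrow> (\<lambda>x. (u x + v x) / 2) \<in> K n"
    and meas: "\<And>n u. u \<in> K n \<Longrightarrow> u \<in> borel_measurable P"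
    and bd: "\<And>n u x. u \<in> K n \<Longrightarrow> 0 \<le> u x \<and> u x \<le> 1"
  shows "\<exists>u. (\<forall>n. u n \<in> K n) \<and>
    (\<forall>e>0. \<exists>N. \<forall>i\<ge>N. \<forall>j\<ge>N. (\<integral>x. norm (u i x - u j x) \<partial>P) < e)"
proof -
  interpret prob_space P by fact
  define s where "s u = (\<integral>x. (u x)\<^sup>2 \<partial>P)" for u :: "'a \<Rightarrow> real"
  define d where "d n = Inf (s ` K n)" for n
  have s0: "0 \<le> s u" for u unfolding s_def by simp
  have bb: "bdd_below (s ` B)" for B using s0 by (intro bdd_belowI[where m=0]) auto
  have sqi: "integrable P (\<lambda>x. (u x)\<^sup>2)" if "u \<in> K n" for u n
    using meas[OF that] bd[OF that] by (intro integral_bounded01) (auto simp: power_le_one)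
  have dle: "d n \<le> s u" if "u \<in> K n" for u n
    unfolding d_def using that bb by (intro cInf_lower) auto
  have s1: "s u \<le> 1" if "u \<in> K n" for u n
  proof -
    have "s u \<le> (\<integral>x. 1 \<partial>P)" unfolding s_def
      using bd[OF that] sqi[OF that] by (intro integral_mono) (auto simp: power_le_one)
    then show ?thesis by (simp add: prob_space)
  qed
  have d1: "d n \<le> 1" for n
    using ne[of n] dle[of _ n] s1[of _ n] by force
  \<comment> \<open>Infima over shrinking sets increase and are bounded by 1, hence converge;
    \<open>key\<close> turns closeness of the infima into closeness of the near minimizers.\<close>
  have "incseq d" unfolding incseq_def d_def
    using ne dec by (auto intro!: cInf_superset_mono bb image_mono simp: decseq_def)
  then have "Cauchy d" using d1 by (metis incseq_convergent LIMSEQ_imp_Cauchy)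
  have "\<exists>u. u \<in> K n \<and> s u < d n + 1 / Suc n" for n
  proof -
    have "Inf (s ` K n) < d n + 1 / Suc n" unfolding d_def by simp
    then show ?thesis using ne[of n] bb by (subst (asm) cInf_less_iff) auto
  qed
  then obtain u where u: "\<And>n. u n \<in> K n" and su: "\<And>n. s (u n) < d n + 1 / Suc n" by metis
  \<comment> \<open>Nestedness puts \<open>u j\<close> into the larger set \<open>K i\<close>, so
    the midpoint is there too and its squared norm is at least \<open>d i\<close>. The parallelogram
    identity then bounds the distance.\<close>
  have key: "(\<integral>x. (u i x - u j x)\<^sup>2 \<partial>P) \<le> 2 * \<bar>d j - d i\<bar> + 4 / Suc i" if "i \<le> j" for i j
  proof -
    have uj: "u j \<in> K i" using u[of j] dec that by (auto simp: decseq_def)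
    note mm = mid[OF u uj]
    define a b where "a = 1 / real (Suc i)" and "b = 1 / real (Suc j)"
    have "(\<integral>x. (u i x - u j x)\<^sup>2 \<partial>P) =
      (\<integral>x. 2 * (u i x)\<^sup>2 + 2 * (u j x)\<^sup>2 - 4 * ((u i x + u j x) / 2)\<^sup>2 \<partial>P)"
      by (intro Bochner_Integration.integral_cong refl) (simp add: field_simps power2_eq_square)
    also have "\<dots> = 2 * s (u i) + 2 * s (u j) - 4 * s (\<lambda>x. (u i x + u j x) / 2)"
      unfolding s_def using sqi[OF u] sqi[OF mm] sqi[OF uj] by simp
    also have "\<dots> \<le> 2 * (d i + a) + 2 * (d j + b) - 4 * d i"
      using su[of i, folded a_def] su[of j, folded b_def] dle[OF mm] by argo
    finally have "(\<integral>x. (u i x - u j x)\<^sup>2 \<partial>P) \<le> 2 * (d j - d i) + 2 * a + 2 * b" by argo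
    moreover have "b \<le> a" using that by (simp add: a_def b_def field_simps)
    moreover have "4 / real (Suc i) = 4 * a" by (simp add: a_def)
    ultimately show ?thesis using abs_ge_self[of "d j - d i"] by argo
  qed
  have L1: "(\<integral>x. norm (u i x - u j x) \<partial>P) < e"
    if "0 < e" and sq: "(\<integral>x. (u i x - u j x)\<^sup>2 \<partial>P) < e\<^sup>2 / 4" for i j e
  proof -
    have [measurable]: "u n \<in> borel_measurable P" for n using meas[OF u] .
    have "\<bar>u i x - u j x\<bar> \<le> 1" for x
      using bd[OF u[of i], of x] bd[OF u[of j], of x] unfolding abs_le_iff by linarith
    then have i1: "integrable P (\<lambda>x. (u i x - u j x)\<^sup>2)"
      by (intro integrable_const_bound[where B=1]) (auto simp: abs_square_le_1)
    \<comment> \<open>Completing the square gives y <= e/2 + 2 y^2 / e pointwise, which passes from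
      the squared norm to the L1 norm. With the threshold e^2/4 the second term contributes less
      than e/2.\<close>
    have "(\<integral>x. norm (u i x - u j x) \<partial>P) \<le> (\<integral>x. e / 2 + (u i x - u j x)\<^sup>2 * (2 / e) \<partial>P)"
    proof (intro integral_mono_AE')
      show "AE x in P. norm (u i x - u j x) \<le> e / 2 + (u i x - u j x)\<^sup>2 * (2 / e)"
      proof (intro always_eventually allI)
        fix x
        define y where "y = \<bar>u i x - u j x\<bar>"
        have "0 \<le> (y - e / 2)\<^sup>2 + y\<^sup>2 + e\<^sup>2 / 4" by simp
        then have "y * e \<le> e\<^sup>2 / 2 + 2 * y\<^sup>2"
          unfolding power2_eq_square by (simp add: algebra_simps)
        then have "y \<le> (e\<^sup>2 / 2 + 2 * y\<^sup>2) / e"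
          using \<open>0 < e\<close> by (subst pos_le_divide_eq) auto
        also have "\<dots> = e / 2 + y\<^sup>2 * (2 / e)"
          using \<open>0 < e\<close> by (simp add: add_divide_distrib power2_eq_square)
        finally have "y \<le> e / 2 + y\<^sup>2 * (2 / e)" .
        then show "norm (u i x - u j x) \<le> e / 2 + (u i x - u j x)\<^sup>2 * (2 / e)" 
          by (simp add: y_def)
      qed
    qed (use i1 \<open>0 < e\<close> in auto)
    also have "\<dots> = e / 2 + (\<integral>x. (u i x - u j x)\<^sup>2 \<partial>P) * (2 / e)"
      using i1 by (simp add: prob_space)
    also have "\<dots> < e / 2 + e\<^sup>2 / 4 * (2 / e)"
      using sq \<open>0 < e\<close> by (intro add_strict_left_mono mult_strict_right_mono) auto
    also have "\<dots> = e" using \<open>0 < e\<close> by (simp add: power2_eq_square)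
    finally show ?thesis .
  qed
  have "\<exists>N. \<forall>i\<ge>N. \<forall>j\<ge>N. (\<integral>x. norm (u i x - u j x) \<partial>P) < e" if "0 < e" for e :: real
  proof -
    \<comment> \<open>In \<open>key\<close>, twice e^2/16 plus four times e^2/32 is e^2/4, the
      threshold demanded by \<open>L1\<close>.\<close>
    have e': "0 < e\<^sup>2 / 16" using that by simp
    obtain N1 where N1: "\<And>i j. i \<ge> N1 \<Longrightarrow> j \<ge> N1 \<Longrightarrow> \<bar>d j - d i\<bar> < e\<^sup>2 / 16"
      using \<open>Cauchy d\<close> e' unfolding Cauchy_def dist_real_def by meson
    obtain N2 where N2: "1 / real (Suc N2) < e\<^sup>2 / 32"
      by (rule nat_approx_posE[of "e\<^sup>2 / 32"]) (use e' in auto)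
    have a: "(\<integral>x. norm (u i x - u j x) \<partial>P) < e" if "i \<ge> max N1 N2" "i \<le> j" for i j
    proof -
      have "1 / real (Suc i) \<le> 1 / real (Suc N2)" using that by (simp add: field_simps)
      then show ?thesis using key[OF \<open>i \<le> j\<close>] N1[of i j] N2 that \<open>0 < e\<close> 
        by (intro L1) auto
    qed
    show ?thesis
    proof (intro exI[of _ "max N1 N2"] allI impI)
      fix i j assume "max N1 N2 \<le> i" "max N1 N2 \<le> j"
      moreover have "(\<integral>x. norm (u i x - u j x) \<partial>P) = (\<integral>x. norm (u j x - u i x) \<partial>P)"
        by (simp only: norm_minus_commute)
      ultimately show "(\<integral>x. norm (u i x - u j x) \<partial>P) < e"
        using a[of i j] a[of j i] by (cases "i \<le> j") simp_all
    qed
  qed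
  with u show ?thesis by blast
qed

text \<open>Nonsingularity suffices to pull back the exceptional set. This generality serves
  \<open>spread\<close>, which shares the null sets of the invariant measure
  \<open>M\<close>.\<close>

lemma AE_compose_nonsingular:
  assumes T: "T \<in> measurable P P"
    and ns: "\<And>B. B \<in> null_sets P \<Longrightarrow> T -` B \<inter> space P \<in> null_sets P"
    and Q: "AE x in P. Q x"
  shows "AE x in P. Q (T x)"
proof -
  obtain N where N: "N \<in> null_sets P" "{x \<in> space P. \<not> Q x} \<subseteq> N"
    using Q by (auto elim!: AE_E simp: null_sets_def)
  show ?thesis
    by (rule AE_I'[OF ns[OF N(1)]]) (use N(2) measurable_space[OF T] in auto)
qed

text \<open>Ergodicity puts almost all values of \<open>h\<close> on one side of any level. A level
  strictly between two different integrals would contradict one of them, as both measures inherit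
  the null sets of \<open>P\<close>.\<close>

lemma ergodic_no_invariant_separation:
  fixes h :: "'a \<Rightarrow> real"
  assumes P: "prob_space P" and T[measurable]: "T \<in> measurable P P"
    and ns: "\<And>B. B \<in> null_sets P \<Longrightarrow> T -` B \<inter> space P \<in> null_sets P"
    and erg: "ergodic P T"
    and N1: "prob_space N1" "sets N1 = sets P" "absolutely_continuous P N1"
    and N2: "prob_space N2" "sets N2 = sets P" "absolutely_continuous P N2"
    and h[measurable]: "h \<in> borel_measurable P" and hT: "AE x in P. h (T x) = h x"
    and h1: "integrable N1 h" and h2: "integrable N2 h"
  shows "(\<integral>x. h x \<partial>N1) = (\<integral>x. h x \<partial>N2)"
proof -
  have main: "\<not> (\<integral>x. h x \<partial>N1) < (\<integral>x. h x \<partial>N2)"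
    if N1: "prob_space N1" "sets N1 = sets P" "absolutely_continuous P N1"
    and N2: "prob_space N2" "sets N2 = sets P" "absolutely_continuous P N2"
    and h1: "integrable N1 h" and h2: "integrable N2 h" for N1 N2
  proof
    assume less: "(\<integral>x. h x \<partial>N1) < (\<integral>x. h x \<partial>N2)"
    then obtain c where c: "(\<integral>x. h x \<partial>N1) < c" "c < (\<integral>x. h x \<partial>N2)" using dense by blast
    interpret N1: prob_space N1 by fact
    interpret N2: prob_space N2 by fact
    have [simp]: "space N1 = space P" "space N2 = space P" 
      using sets_eq_imp_space_eq[OF N1(2)] sets_eq_imp_space_eq[OF N2(2)] by simp_all
    have Tk[measurable]: "T ^^ k \<in> measurable P P" for k by measurable
    \<comment> \<open>\<open>ergodic\<close> asks for exact invariance, while \<open>h\<close> is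
      invariant only almost everywhere. The tail event along the orbit is exactly invariant and
      agrees almost everywhere with \<open>c < h x\<close>.\<close>
    define B where "B = {x \<in> space P. \<exists>m. \<forall>n\<ge>m. c < h ((T ^^ n) x)}"
    have Bs[measurable]: "B \<in> sets P" unfolding B_def by measurable
    have "T -` B \<inter> space P = B"
    proof -
      have "(\<exists>m. \<forall>n\<ge>m. c < h ((T ^^ n) (T x))) \<longleftrightarrow> (\<exists>m. \<forall>n\<ge>m. c < h ((T ^^ n) x))" for x
      proof -
        have "(T ^^ n) (T x) = (T ^^ Suc n) x" for n by (simp add: funpow_swap1)
        then have "(\<exists>m. \<forall>n\<ge>m. c < h ((T ^^ n) (T x))) \<longleftrightarrow> 
          (\<forall>\<^sub>F n in sequentially. c < h ((T ^^ (Suc n)) x))"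
          by (simp add: eventually_sequentially)
        also have "\<dots> \<longleftrightarrow> (\<exists>m. \<forall>n\<ge>m. c < h ((T ^^ n) x))"
          by (subst eventually_sequentially_Suc) (simp add: eventually_sequentially)
        finally show ?thesis .
      qed
      then show ?thesis using measurable_space[OF T] by (auto simp: B_def)
    qed
    then have dich: "emeasure P B = 0 \<or> emeasure P (space P - B) = 0"
      using erg Bs unfolding ergodic_def by blast
    have inv: "AE x in P. h ((T ^^ n) x) = h x" for n
    proof (induction n)
      case (Suc n)
      have "AE x in P. h ((T ^^ n) (T x)) = h (T x)"
        by (rule AE_compose_nonsingular[OF T ns Suc])
      then show ?case using hT by eventually_elim (simp add: funpow_swap1)
    qed simp
    then have invall: "AE x in P. \<forall>n. h ((T ^^ n) x) = h x" by (simp add: AE_all_countable)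
    have ac: "AE x in N. Q x" if "absolutely_continuous P N" "sets N = sets P" "AE x in P. Q x" for N Q
      using absolutely_continuous_AE[OF that(2) that(1) that(3)] .
    from dich show False
    proof
      assume "emeasure P B = 0"
      then have "AE x in P. x \<notin> B" by (intro AE_not_in) auto
      then have "AE x in P. h x \<le> c" using invall AE_space
        by eventually_elim (auto simp: B_def)
      then have "AE x in N2. h x \<le> c" using ac N2 by blast
      then have "(\<integral>x. h x \<partial>N2) \<le> (\<integral>x. c \<partial>N2)" using h2 by (intro integral_mono_AE) auto
      with c show False by (simp add: N2.prob_space[simplified])
    next
      assume "emeasure P (space P - B) = 0"
      then have "AE x in P. x \<notin> space P - B" by (intro AE_not_in) auto
      then have "AE x in P. c \<le> h x" using invall AE_space
        by eventually_elim (auto simp: B_def intro!: less_imp_le)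
      then have "AE x in N1. c \<le> h x" using ac N1 by blast
      then have "(\<integral>x. c \<partial>N1) \<le> (\<integral>x. h x \<partial>N1)" using h1 by (intro integral_mono_AE) auto
      with c show False by (simp add: N1.prob_space[simplified])
    qed
  qed
  show ?thesis using main[OF N1 N2 h1 h2] main[OF N2 N1 h2 h1] by linarith
qed

text \<open>A limit of the approximating functions would be an invariant function separating the two
  measures. Near minimizers in the nested convex sets \<open>K n\<close> provide such a limit almost
  everywhere along a subsequence.\<close>

lemma no_asymptotically_invariant_separation:
  fixes c d :: real
  assumes "prob_space P" and T[measurable]: "T \<in> measurable P P"
    and ns: "\<And>B. B \<in> null_sets P \<Longrightarrow> T -` B \<inter> space P \<in> null_sets P"
    and erg: "ergodic P T"
    and N1: "prob_space N1" "sets N1 = sets P" "absolutely_continuous P N1"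
    and N2: "prob_space N2" "sets N2 = sets P" "absolutely_continuous P N2"
    and "c < d"
    and K: "\<And>e. 0 < e \<Longrightarrow> \<exists>u. u \<in> borel_measurable P \<and> (\<forall>x. 0 \<le> u x \<and> u x \<le> 1) \<and>
      d \<le> (\<integral>x. u x \<partial>N2) \<and> (\<integral>x. u x \<partial>N1) \<le> c + e \<and> (\<integral>x. \<bar>u (T x) - u x\<bar> \<partial>P) \<le> e"
  shows False
proof -
  interpret prob_space P by fact
  interpret N1: prob_space N1 by fact
  interpret N2: prob_space N2 by fact
  have [simp]: "space N1 = space P" "space N2 = space P"
    using sets_eq_imp_space_eq[OF N1(2)] sets_eq_imp_space_eq[OF N2(2)] by simp_all
  note [measurable_cong] = N1(2) N2(2)
  \<comment> \<open>Every constraint survives midpoints: the integrals are affine in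
    \<open>u\<close> and the defect of invariance is convex. The slack vanishes in the
    limit.\<close>
  define K where "K n = {u. u \<in> borel_measurable P \<and> (\<forall>x. 0 \<le> u x \<and> u x \<le> 1) \<and>
      d \<le> (\<integral>x. u x \<partial>N2) \<and> (\<integral>x. u x \<partial>N1) \<le> c + 1 / Suc n \<and>
      (\<integral>x. \<bar>u (T x) - u x\<bar> \<partial>P) \<le> 1 / Suc n}" for n :: nat
  have KD: "u \<in> borel_measurable P" "0 \<le> u x" "u x \<le> 1" 
      "d \<le> (\<integral>x. u x \<partial>N2)" "(\<integral>x. u x \<partial>N1) \<le> c + 1 / Suc n"
      "(\<integral>x. \<bar>u (T x) - u x\<bar> \<partial>P) \<le> 1 / Suc n" if "u \<in> K n" for u n x
    using that by (auto simp: K_def)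
  have KN: "integrable N1 u" "integrable N2 u" if "u \<in> K n" for u n
    using KD[OF that] by (auto intro!: N1.integral_bounded01 N2.integral_bounded01)
  have KT: "integrable P (\<lambda>x. \<bar>u (T x) - u x\<bar>)" if "u \<in> K n" for u n
  proof -
    have [measurable]: "u \<in> borel_measurable P" using KD(1)[OF that] .
    have "\<bar>u (T x) - u x\<bar> \<le> 1" for x
      using KD(2,3)[OF that, of x] KD(2,3)[OF that, of "T x"] by linarith
    then show ?thesis by (intro integral_bounded01) auto
  qed
  have ne: "K n \<noteq> {}" for n using K[of "1 / Suc n"] by (auto simp: K_def)
  have dec: "decseq K" unfolding decseq_def
  proof (intro allI impI subsetI)
    fix m n :: nat and u assume "m \<le> n" "u \<in> K n"
    moreover have "1 / real (Suc n) \<le> 1 / Suc m" using \<open>m \<le> n\<close> by (simp add: field_simps)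
    ultimately show "u \<in> K m" by (auto simp: K_def)
  qed
  have mid: "(\<lambda>x. (u x + v x) / 2) \<in> K n" if u: "u \<in> K n" and v: "v \<in> K n" for n u v
  proof -
    have [measurable]: "u \<in> borel_measurable P" "v \<in> borel_measurable P" 
      using KD(1) u v by auto
    have abs: "\<bar>(p + q) / 2 - (p' + q') / 2\<bar> \<le> (\<bar>p - p'\<bar> + \<bar>q - q'\<bar>) / 2" for p q p' q' :: real
    proof -
      have "\<bar>(p + q) / 2 - (p' + q') / 2\<bar> = \<bar>(p - p') + (q - q')\<bar> / 2"
        by (subst diff_divide_distrib[symmetric]) (simp add: algebra_simps)
      also have "\<dots> \<le> (\<bar>p - p'\<bar> + \<bar>q - q'\<bar>) / 2"
        by (intro divide_right_mono abs_triangle_ineq) simp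
      finally show ?thesis .
    qed
    have "(\<integral>x. \<bar>(u (T x) + v (T x)) / 2 - (u x + v x) / 2\<bar> \<partial>P) \<le> 
        (\<integral>x. (\<bar>u (T x) - u x\<bar> + \<bar>v (T x) - v x\<bar>) / 2 \<partial>P)"
      using KT[OF u] KT[OF v]
      by (intro integral_mono_AE' always_eventually allI abs) auto
    also have "\<dots> \<le> 1 / Suc n" using KT[OF u] KT[OF v] KD(6)[OF u] KD(6)[OF v] by simp
    finally have "(\<integral>x. \<bar>(u (T x) + v (T x)) / 2 - (u x + v x) / 2\<bar> \<partial>P) \<le> 1 / Suc n" .
    moreover have "0 \<le> (u x + v x) / 2 \<and> (u x + v x) / 2 \<le> 1" for x
      using KD(2,3)[OF u, of x] KD(2,3)[OF v, of x] by simp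
    ultimately show ?thesis
      using KD(4,5)[OF u] KD(4,5)[OF v] KN[OF u] KN[OF v] by (simp add: K_def)
  qed
  have "\<exists>u. (\<forall>n. u n \<in> K n) \<and>
    (\<forall>e>0. \<exists>N. \<forall>i\<ge>N. \<forall>j\<ge>N. (\<integral>x. norm (u i x - u j x) \<partial>P) < e)"
    by (rule nested_convex_L1_Cauchy[OF \<open>prob_space P\<close> ne dec mid KD(1)]) (use KD(2,3) in blast)+
  then obtain u where u: "\<And>n. u n \<in> K n" and
    C: "\<And>e. e > 0 \<Longrightarrow> \<exists>N. \<forall>i\<ge>N. \<forall>j\<ge>N. (\<integral>x. norm (u i x - u j x) \<partial>P) < e"
    by blast
  have um[measurable]: "u n \<in> borel_measurable P" for n using KD(1)[OF u] .
  have ui: "integrable P (u n)" for n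
    using KD[OF u] by (intro integral_bounded01) auto
  \<comment> \<open>Almost everywhere convergence transfers from \<open>P\<close> to
    \<open>N1\<close> and \<open>N2\<close> by absolute continuity; boundedness by 1 then gives
    convergence of all the integrals.\<close>
  obtain r where r: "strict_mono r" and Ca: "AE x in P. Cauchy (\<lambda>i. u (r i) x)"
    using cauchy_L1_AE_cauchy_subseq[OF ui C] by blast
  define h where "h x = lim (\<lambda>i. u (r i) x)" for x
  have hm[measurable]: "h \<in> borel_measurable P" unfolding h_def by measurable
  have lim: "AE x in P. (\<lambda>i. u (r i) x) \<longlonglongrightarrow> h x"
    using Ca by eventually_elim (simp add: h_def Cauchy_convergent_iff convergent_LIMSEQ_iff)
  have limT: "AE x in P. (\<lambda>i. u (r i) (T x)) \<longlonglongrightarrow> h (T x)"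
    by (rule AE_compose_nonsingular[OF T ns lim])
  have inv: "(\<lambda>i. \<integral>x. \<bar>u (r i) (T x) - u (r i) x\<bar> \<partial>P) \<longlonglongrightarrow> (\<integral>x. \<bar>h (T x) - h x\<bar> \<partial>P)"
    "integrable P (\<lambda>x. \<bar>h (T x) - h x\<bar>)"
  proof -
    have a: "AE x in P. (\<lambda>i. \<bar>u (r i) (T x) - u (r i) x\<bar>) \<longlonglongrightarrow> \<bar>h (T x) - h x\<bar>"
      using lim limT by eventually_elim (intro tendsto_intros)
    have "\<bar>u (r i) (T x) - u (r i) x\<bar> \<le> 1" for i x
      using KD(2,3)[OF u[of "r i"], of x] KD(2,3)[OF u[of "r i"], of "T x"] by linarith
    then have b: "AE x in P. norm \<bar>u (r i) (T x) - u (r i) x\<bar> \<le> 1" for i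
      by simp
    show "(\<lambda>i. \<integral>x. \<bar>u (r i) (T x) - u (r i) x\<bar> \<partial>P) \<longlonglongrightarrow> (\<integral>x. \<bar>h (T x) - h x\<bar> \<partial>P)"
      by (rule integral_dominated_convergence[OF _ _ _ a b]) auto
    show "integrable P (\<lambda>x. \<bar>h (T x) - h x\<bar>)"
      by (rule integrable_dominated_convergence[OF _ _ _ a b]) auto
  qed
  have conv: "(\<lambda>i. \<integral>x. u (r i) x \<partial>N) \<longlonglongrightarrow> (\<integral>x. h x \<partial>N)" "integrable N h"
    if N: "prob_space N" "sets N = sets P" "absolutely_continuous P N" for N
  proof -
    interpret N: prob_space N by fact
    note [measurable_cong] = N(2)
    have a: "AE x in N. (\<lambda>i. u (r i) x) \<longlonglongrightarrow> h x"
      using absolutely_continuous_AE[OF N(2,3) lim] .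
    have b: "AE x in N. norm (u (r i) x) \<le> 1" for i
      using KD(2,3)[OF u] by auto
    show "(\<lambda>i. \<integral>x. u (r i) x \<partial>N) \<longlonglongrightarrow> (\<integral>x. h x \<partial>N)"
      by (rule integral_dominated_convergence[OF _ _ _ a b]) auto
    show "integrable N h"
      by (rule integrable_dominated_convergence[OF _ _ _ a b]) auto
  qed
  have r0: "(\<lambda>i. 1 / real (Suc (r i))) \<longlonglongrightarrow> 0"
    using LIMSEQ_subseq_LIMSEQ[OF LIMSEQ_inverse_real_of_nat r] by (simp add: o_def inverse_eq_divide)
  have "(\<integral>x. \<bar>h (T x) - h x\<bar> \<partial>P) \<le> 0"
    using KD(6)[OF u] by (intro LIMSEQ_le[OF inv(1) r0]) auto
  then have "(\<integral>x. \<bar>h (T x) - h x\<bar> \<partial>P) = 0"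
    by (intro antisym) auto
  then have "AE x in P. \<bar>h (T x) - h x\<bar> = 0"
    by (subst (asm) integral_nonneg_eq_0_iff_AE[OF inv(2)]) auto
  then have hT: "AE x in P. h (T x) = h x" by simp
  have eq: "(\<integral>x. h x \<partial>N1) = (\<integral>x. h x \<partial>N2)"
    using ergodic_no_invariant_separation[OF \<open>prob_space P\<close> T ns erg N1 N2 hm hT]
      conv(2)[OF N1] conv(2)[OF N2] by blast
  have "d \<le> (\<integral>x. h x \<partial>N2)"
    using KD(4)[OF u] by (intro LIMSEQ_le_const[OF conv(1)[OF N2]]) auto
  moreover have "(\<integral>x. h x \<partial>N1) \<le> c + 0"
    using KD(5)[OF u] by (intro LIMSEQ_le[OF conv(1)[OF N1] tendsto_add[OF tendsto_const r0]]) auto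
  ultimately show False using eq \<open>c < d\<close> by simp
qed

text \<open>If the \<open>N2\<close>-probabilities exceeded the limit by a fixed amount infinitely
  often, indicators of these events would be the functions excluded by
  \<open>no_asymptotically_invariant_separation\<close>. Complements, which are just as nearly
  invariant, give the other bound.\<close>

lemma asymptotically_invariant_events:
  assumes P: "prob_space P" and T[measurable]: "T \<in> measurable P P"
    and ns: "\<And>B. B \<in> null_sets P \<Longrightarrow> T -` B \<inter> space P \<in> null_sets P"
    and erg: "ergodic P T"
    and N1: "prob_space N1" "sets N1 = sets P" "absolutely_continuous P N1"
    and N2: "prob_space N2" "sets N2 = sets P" "absolutely_continuous P N2"
    and E[measurable]: "\<And>n. E n \<in> sets P"
    and inv: "(\<lambda>n. measure P (sym_diff (T -` E n \<inter> space P) (E n))) \<longlonglongrightarrow> 0"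
    and lim: "(\<lambda>n. measure N1 (E n)) \<longlonglongrightarrow> c"
  shows "(\<lambda>n. measure N2 (E n)) \<longlonglongrightarrow> c"
proof -
  interpret P: prob_space P by fact
  interpret N1: prob_space N1 by fact
  interpret N2: prob_space N2 by fact
  have [simp]: "space N1 = space P" "space N2 = space P"
    using sets_eq_imp_space_eq[OF N1(2)] sets_eq_imp_space_eq[OF N2(2)] by simp_all
  note [measurable_cong] = N1(2) N2(2)
  have upper: "\<forall>\<^sub>F n in sequentially. measure N2 (E n) < c + \<delta>"
    if E[measurable]: "\<And>n. E n \<in> sets P"
      and inv: "(\<lambda>n. measure P (sym_diff (T -` E n \<inter> space P) (E n))) \<longlonglongrightarrow> 0"
      and lim: "(\<lambda>n. measure N1 (E n)) \<longlonglongrightarrow> c" and "0 < \<delta>" for E \<delta> c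
  proof (rule ccontr)
    assume "\<not> ?thesis"
    then have freq: "\<exists>\<^sub>F n in sequentially. c + \<delta> \<le> measure N2 (E n)"
      by (simp add: not_eventually not_less)
    have c: "c < c + \<delta>" using that by simp
    show False
    proof (rule no_asymptotically_invariant_separation[OF P T ns erg N1 N2 c])
      fix e :: real assume "0 < e"
      have "\<forall>\<^sub>F n in sequentially. measure N1 (E n) < c + e"
        using lim \<open>0 < e\<close> by (intro order_tendstoD) auto
      moreover have "\<forall>\<^sub>F n in sequentially. measure P (sym_diff (T -` E n \<inter> space P) (E n)) < e"
        using inv \<open>0 < e\<close> by (intro order_tendstoD) auto
      ultimately have "\<forall>\<^sub>F n in sequentially. measure N1 (E n) < c + e \<and> 
          measure P (sym_diff (T -` E n \<inter> space P) (E n)) < e"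
        by eventually_elim auto
      then obtain n where n: "c + \<delta> \<le> measure N2 (E n)" "measure N1 (E n) < c + e"
          "measure P (sym_diff (T -` E n \<inter> space P) (E n)) < e"
        using frequently_ex[OF frequently_eventually_conj[OF freq]] by auto
      have [simp]: "E n \<subseteq> space P" using sets.sets_into_space[OF E] .
      have "(\<integral>x. \<bar>indicator (E n) (T x) - indicator (E n) x :: real\<bar> \<partial>P) =
          (\<integral>x. indicator (sym_diff (T -` E n \<inter> space P) (E n)) x \<partial>P)"
        by (intro Bochner_Integration.integral_cong refl) (auto split: split_indicator)
      also have "\<dots> = measure P (sym_diff (T -` E n \<inter> space P) (E n))"
        by (subst Bochner_Integration.integral_indicator) (simp add: Int_Un_distrib2 Diff_Int_distrib2 Int_absorb2)
      finally have "(\<integral>x. \<bar>indicator (E n) (T x) - indicator (E n) x :: real\<bar> \<partial>P) \<le> e"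
        using n(3) by simp
      moreover have "(\<integral>x. indicator (E n) x \<partial>N2) = measure N2 (E n)"
          "(\<integral>x. indicator (E n) x \<partial>N1) = measure N1 (E n)"
        using Bochner_Integration.integral_indicator[of N2 "E n"] Bochner_Integration.integral_indicator[of N1 "E n"]
        by (simp_all only: \<open>space N1 = space P\<close> \<open>space N2 = space P\<close> Int_absorb2[OF \<open>E n \<subseteq> space P\<close>])
      ultimately show "\<exists>u. u \<in> borel_measurable P \<and> (\<forall>x. 0 \<le> u x \<and> u x \<le> 1) \<and>
        c + \<delta> \<le> (\<integral>x. u x \<partial>N2) \<and> (\<integral>x. u x \<partial>N1) \<le> c + e \<and> (\<integral>x. \<bar>u (T x) - u x\<bar> \<partial>P) \<le> e"
        using n(1,2)
        by (intro exI[of _ "indicator (E n)"] conjI allI) (simp_all add: indicator_le_1)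
    qed
  qed
  have inv': "(\<lambda>n. measure P (sym_diff (T -` (space P - E n) \<inter> space P) (space P - E n))) \<longlonglongrightarrow> 0"
  proof -
    have "sym_diff (T -` (space P - E n) \<inter> space P) (space P - E n) = 
      sym_diff (T -` E n \<inter> space P) (E n)" for n
      using sets.sets_into_space[OF E[of n]] measurable_space[OF T] by auto
    then show ?thesis using inv by simp
  qed
  have lim': "(\<lambda>n. measure N1 (space P - E n)) \<longlonglongrightarrow> 1 - c"
  proof -
    have "measure N1 (space P - E n) = 1 - measure N1 (E n)" for n
      using N1.prob_compl[of "E n"] N1(2) by simp
    then show ?thesis using tendsto_diff[OF tendsto_const lim, of 1] by simp
  qed
  show ?thesis
  proof (rule order_tendstoI)
    fix a assume "c < a"
    then show "\<forall>\<^sub>F n in sequentially. measure N2 (E n) < a"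
      using upper[OF E inv lim, of "a - c"] by simp
  next
    fix a assume "a < c"
    have "measure N2 (space P - E n) = 1 - measure N2 (E n)" for n
      using N2.prob_compl[of "E n"] N2(2) by simp
    then show "\<forall>\<^sub>F n in sequentially. a < measure N2 (E n)"
      using upper[OF _ inv' lim', of "c - a"] \<open>a < c\<close> by simp
  qed
qed

section \<open>Recurrence and last visits\<close>

lemma measurable_pre_iter:
  assumes "T \<in> measurable M M" "B \<in> sets M"
  shows "pre_iter M T k B \<in> sets M"
proof -
  have "T ^^ k \<in> measurable M M" using assms(1) by measurable
  then show ?thesis unfolding pre_iter_def using assms(2) by (rule measurable_sets)
qed

lemma pre_iter_Suc: 
  assumes "T \<in> measurable M M"
  shows "pre_iter M T (Suc k) B = T -` pre_iter M T k B \<inter> space M"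
  using measurable_space[OF assms] by (auto simp: pre_iter_def funpow_swap1)

lemma emeasure_pre_iter:
  assumes mp: "measure_preserving M T" and B: "B \<in> sets M"
  shows "emeasure M (pre_iter M T k B) = emeasure M B"
proof (induction k)
  case 0
  show ?case using sets.sets_into_space[OF B] by (simp add: pre_iter_def Int_absorb2)
next
  case (Suc k)
  have T: "T \<in> measurable M M" using mp by (simp add: measure_preserving_def)
  show ?case unfolding pre_iter_Suc[OF T]
    using mp Suc measurable_pre_iter[OF T B, of k] by (simp add: measure_preserving_def)
qed

lemma null_sets_pre_iter:
  assumes "measure_preserving M T" "B \<in> null_sets M"
  shows "pre_iter M T k B \<in> null_sets M"
  using assms emeasure_pre_iter[of M T B k] measurable_pre_iter[of T M B k]
  by (auto simp: null_sets_def measure_preserving_def)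

text \<open>The points of \<open>C\<close> that never return form a wandering, hence null, set. A
  point of \<open>C\<close> with finitely many visits enters that set at its last visit, so the
  event of infinitely many visits cannot be null, and ergodicity makes it full.\<close>

lemma conservative_ergodic_recurrence:
  assumes mp: "measure_preserving M T" and cons: "conservative M T" and erg: "ergodic M T"
    and C[measurable]: "C \<in> sets M" and pos: "0 < emeasure M C"
  shows "AE x in M. \<forall>m. \<exists>n\<ge>m. (T ^^ n) x \<in> C"
proof -
  have T[measurable]: "T \<in> measurable M M" using mp by (simp add: measure_preserving_def)
  have Tk[measurable]: "T ^^ k \<in> measurable M M" for k by measurable
  define D where "D = {x \<in> space M. x \<in> C \<and> (\<forall>n\<ge>1. (T ^^ n) x \<notin> C)}"
  have D[measurable]: "D \<in> sets M" unfolding D_def by measurable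
  have dis: "pre_iter M T i D \<inter> pre_iter M T j D = {}" if "i < j" for i j
  proof -
    have False if x: "(T ^^ i) x \<in> D" "(T ^^ j) x \<in> D" for x
    proof -
      have "(T ^^ j) x = (T ^^ (j - i)) ((T ^^ i) x)"
        using \<open>i < j\<close> by (metis add_diff_cancel_left' funpow_add le_add_diff_inverse less_imp_le o_apply add.commute)
      moreover have "1 \<le> j - i" using \<open>i < j\<close> by simp
      ultimately show False using x by (auto simp: D_def)
    qed
    then show ?thesis by (auto simp: pre_iter_def)
  qed
  have "wandering_set M T D" unfolding wandering_set_def disjoint_family_on_def
    using dis D by (metis Int_commute linorder_neqE_nat)
  then have "D \<in> null_sets M" using cons D by (auto simp: conservative_def null_sets_def)
  then have nD: "pre_iter M T k D \<in> null_sets M" for k using null_sets_pre_iter[OF mp] by blast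
  define B where "B = {x \<in> space M. \<forall>m. \<exists>n\<ge>m. (T ^^ n) x \<in> C}"
  have B[measurable]: "B \<in> sets M" unfolding B_def by measurable
  have "T -` B \<inter> space M = B"
  proof -
    have "(\<forall>m. \<exists>n\<ge>m. (T ^^ n) (T x) \<in> C) \<longleftrightarrow> (\<forall>m. \<exists>n\<ge>m. (T ^^ n) x \<in> C)" for x
    proof -
      have "(T ^^ n) (T x) = (T ^^ Suc n) x" for n by (simp add: funpow_swap1)
      then have "(\<forall>m. \<exists>n\<ge>m. (T ^^ n) (T x) \<in> C) \<longleftrightarrow> 
          (\<exists>\<^sub>F n in sequentially. (T ^^ (Suc n)) x \<in> C)"
        by (simp add: frequently_sequentially)
      also have "\<dots> \<longleftrightarrow> (\<forall>m. \<exists>n\<ge>m. (T ^^ n) x \<in> C)"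
        unfolding frequently_def 
        by (subst eventually_sequentially_Suc) (simp add: eventually_sequentially)
      finally show ?thesis .
    qed
    then show ?thesis using measurable_space[OF T] by (auto simp: B_def)
  qed
  then have "emeasure M B = 0 \<or> emeasure M (space M - B) = 0"
    using erg B unfolding ergodic_def by blast
  moreover have "emeasure M B \<noteq> 0"
  proof
    assume "emeasure M B = 0"
    then have "B \<union> (\<Union>k. pre_iter M T k D) \<in> null_sets M"
      using nD by (intro null_sets.Un null_sets_UN) (auto simp: null_sets_def)
    moreover have "C \<subseteq> B \<union> (\<Union>k. pre_iter M T k D)"
    proof
      fix x assume x: "x \<in> C"
      then have xs: "x \<in> space M" using sets.sets_into_space[OF C] by auto
      show "x \<in> B \<union> (\<Union>k. pre_iter M T k D)"
      proof (cases "x \<in> B")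
        case False
        then obtain m where m: "\<And>n. m \<le> n \<Longrightarrow> (T ^^ n) x \<notin> C" using xs by (auto simp: B_def)
        define k where "k = Max {n. n \<le> m \<and> (T ^^ n) x \<in> C}"
        have "(T ^^ 0) x \<in> C" using x by simp
        then have ne: "{n. n \<le> m \<and> (T ^^ n) x \<in> C} \<noteq> {}" by blast
        have k: "(T ^^ k) x \<in> C" using Max_in[OF _ ne] by (auto simp: k_def)
        have last: "n \<le> k" if "(T ^^ n) x \<in> C" for n
          unfolding k_def using that m[of n] by (intro Max_ge) (auto intro: leI)
        have "(T ^^ n) ((T ^^ k) x) \<notin> C" if "n \<ge> 1" for n
        proof
          assume "(T ^^ n) ((T ^^ k) x) \<in> C"
          then have "n + k \<le> k" by (intro last) (simp add: funpow_add)
          then show False using that by simp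
        qed
        then have "x \<in> pre_iter M T k D"
          using xs k measurable_space[OF Tk xs] by (auto simp: pre_iter_def D_def)
        then show ?thesis by blast
      qed blast
    qed
    ultimately have "C \<in> null_sets M" using C by (meson null_sets_subset)
    then show False using pos by (auto simp: null_sets_def)
  qed
  ultimately have "emeasure M (space M - B) = 0" by blast
  then have "AE x in M. x \<notin> space M - B" by (intro AE_not_in) auto
  with AE_space show ?thesis by eventually_elim (auto simp: B_def)
qed

section \<open>Decomposition of visits by the last visit time\<close>

locale recurrent_system = sigma_finite_measure M for M :: "'a measure" +
  fixes T :: "'a \<Rightarrow> 'a" and A :: "'a set"
  assumes infinite_space: "emeasure M (space M) = \<infinity>"
    and mp: "measure_preserving M T" and cons: "conservative M T" and erg: "ergodic M T"
    and A_sets[measurable]: "A \<in> sets M"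
    and A_pos: "0 < emeasure M A" and A_fin: "emeasure M A < \<infinity>"
begin

text \<open>This is the part of \<open>A\<close> where the first return time exceeds
  \<open>i\<close>, see \<open>return_tail_eq\<close>; finitely many times replace the extended
  naturals.\<close>

definition noret :: "nat \<Rightarrow> 'a set" where
  "noret i = {x \<in> A. \<forall>l\<in>{1..i}. (T ^^ l) x \<notin> A}"

text \<open>\<open>visits m j\<close> is the event that \<open>A\<close> is visited at some time in \<open>(m - j, m]\<close>; it is only
  used for \<open>j \<le> m + 1\<close>, where the subtraction does not truncate.\<close>

definition visits :: "nat \<Rightarrow> nat \<Rightarrow> 'a set" where
  "visits m j = {x \<in> space M. \<exists>i<j. (T ^^ (m - i)) x \<in> A}"

text \<open>The index is shifted against the wandering rate so that \<open>w j\<close> belongs to a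
  window of \<open>j\<close> consecutive times.\<close>

definition w :: "nat \<Rightarrow> real" where
  "w j = (\<Sum>i<j. measure M (noret i))"

lemma T_meas[measurable]: "T \<in> measurable M M"
  using mp by (simp add: measure_preserving_def)

lemma T_pow_meas[measurable]: "T ^^ k \<in> measurable M M"
  by measurable

lemma A_space: "x \<in> A \<Longrightarrow> x \<in> space M"
  using sets.sets_into_space[OF A_sets] by auto

lemma pre_iter_sets: "B \<in> sets M \<Longrightarrow> pre_iter M T k B \<in> sets M"
  by (rule measurable_pre_iter) auto

lemma noret_sets[measurable]: "noret i \<in> sets M"
proof -
  have "noret i = A \<inter> {x \<in> space M. \<forall>l\<in>{1..i}. (T ^^ l) x \<notin> A}"
    using A_space by (auto simp: noret_def)
  also have "\<dots> \<in> sets M" by measurable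
  finally show ?thesis .
qed

lemma visits_sets[measurable]: "visits m j \<in> sets M"
  unfolding visits_def by measurable

lemma noret_subset: "noret i \<subseteq> A"
  by (auto simp: noret_def)

lemma noret_antimono: "i \<le> j \<Longrightarrow> noret j \<subseteq> noret i"
  by (auto simp: noret_def)

lemma A_fmeasurable: "A \<in> fmeasurable M"
  using A_fin by (auto intro: fmeasurableI)

lemma noret_fmeasurable: "noret i \<in> fmeasurable M"
  using fmeasurableI2[OF A_fmeasurable noret_subset noret_sets] .

lemma return_tail_eq: "return_tail M T A i = measure M (noret i)"
proof -
  have "A \<inter> {x. enat i < return_time T A x} = noret i"
    by (auto simp: noret_def return_time_def Suc_ile_eq[symmetric] le_INF_iff)
  then show ?thesis by (simp add: return_tail_def)
qed

lemma sum_return_tail: "(\<Sum>k=0..n. return_tail M T A k) = w (Suc n)"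
  by (simp add: return_tail_eq w_def atLeast0AtMost lessThan_Suc_atMost)

lemma hit_set_eq: "hit_set M T A n = visits n (Suc n)"
proof -
  have "(\<exists>k\<le>n. P k) \<longleftrightarrow> (\<exists>i<Suc n. P (n - i))" for P
    by (metis diff_diff_cancel diff_le_self less_Suc_eq_le)
  from this[of "\<lambda>k. (T ^^ k) _ \<in> A"] show ?thesis
    by (auto simp: set_eq_iff hit_set_def visits_def pre_iter_def Bex_def)
qed

text \<open>Extending the window backwards by the time \<open>m - j\<close> adds exactly the points
  whose last visit up to \<open>m\<close> occurs then: they are in \<open>A\<close> at that time and
  stay away for the next \<open>j\<close> steps.\<close>

lemma visits_Suc:
  assumes "j \<le> m"
  shows "visits m (Suc j) = visits m j \<union> pre_iter M T (m - j) (noret j)"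
    "visits m j \<inter> pre_iter M T (m - j) (noret j) = {}"
proof -
  have split: "(T ^^ l) ((T ^^ (m - j)) x) = (T ^^ (m - (j - l))) x" if "l \<le> j" for l x
  proof -
    have "m - (j - l) = l + (m - j)" using that assms by simp
    then show ?thesis by (simp add: funpow_add)
  qed
  have "x \<in> pre_iter M T (m - j) (noret j) \<longleftrightarrow>
      x \<in> space M \<and> (T ^^ (m - j)) x \<in> A \<and> (\<forall>i<j. (T ^^ (m - i)) x \<notin> A)" for x
  proof -
    have "(\<forall>l\<in>{1..j}. (T ^^ (m - (j - l))) x \<notin> A) \<longleftrightarrow> (\<forall>i<j. (T ^^ (m - i)) x \<notin> A)"
    proof safe
      fix i assume *: "\<forall>l\<in>{1..j}. (T ^^ (m - (j - l))) x \<notin> A" "i < j" "(T ^^ (m - i)) x \<in> A"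
      then have "m - (j - (j - i)) = m - i" "j - i \<in> {1..j}" by auto
      with *(1,3) show False by metis
    next
      fix l assume *: "\<forall>i<j. (T ^^ (m - i)) x \<notin> A" "l \<in> {1..j}" "(T ^^ (m - (j - l))) x \<in> A"
      then have "j - l < j" by auto
      with *(1,3) show False by blast
    qed
    moreover have "(\<forall>l\<in>{1..j}. (T ^^ l) ((T ^^ (m - j)) x) \<notin> A) \<longleftrightarrow> 
        (\<forall>l\<in>{1..j}. (T ^^ (m - (j - l))) x \<notin> A)"
      using split by auto
    ultimately show ?thesis by (auto simp: pre_iter_def noret_def)
  qed
  then show "visits m (Suc j) = visits m j \<union> pre_iter M T (m - j) (noret j)"
    "visits m j \<inter> pre_iter M T (m - j) (noret j) = {}"
    by (auto simp: visits_def less_Suc_eq)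
qed

text \<open>Iterating \<open>visits_Suc\<close> gives a disjoint decomposition, whatever the
  measure. Under \<open>M\<close> invariance removes the preimages; under \<nu> they carry the
  return probabilities.\<close>

lemma emeasure_visits:
  assumes "sets N = sets M" "j \<le> Suc m"
  shows "emeasure N (visits m j) = (\<Sum>i<j. emeasure N (pre_iter M T (m - i) (noret i)))"
  using assms(2)
proof (induction j)
  case 0
  show ?case by (simp add: visits_def)
next
  case (Suc j)
  then have j: "j \<le> m" by simp
  show ?case using Suc assms(1) visits_Suc[OF j]
    by (simp add: plus_emeasure[symmetric] pre_iter_sets noret_sets visits_sets)
qed

lemma measure_visits:
  assumes "finite_measure N" "sets N = sets M" "j \<le> Suc m"
  shows "measure N (visits m j) = (\<Sum>i<j. measure N (pre_iter M T (m - i) (noret i)))"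
proof -
  interpret finite_measure N by fact
  show ?thesis using emeasure_visits[OF assms(2,3)]
    by (simp add: emeasure_eq_measure sum_nonneg)
qed

lemma emeasure_visits_M:
  assumes "j \<le> Suc m"
  shows "emeasure M (visits m j) = ennreal (w j)"
proof -
  have "emeasure M (visits m j) = (\<Sum>i<j. emeasure M (noret i))"
    using emeasure_visits[OF refl assms] emeasure_pre_iter[OF mp noret_sets] by simp
  also have "\<dots> = (\<Sum>i<j. ennreal (measure M (noret i)))"
    using noret_fmeasurable by (intro sum.cong refl emeasure_eq_measure2)
  also have "\<dots> = ennreal (w j)" by (simp add: w_def)
  finally show ?thesis .
qed

lemma measure_visits_M: "j \<le> Suc m \<Longrightarrow> measure M (visits m j) = w j"
  by (simp add: measure_def emeasure_visits_M w_def sum_nonneg)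

lemma wandering_rate_eq: "wandering_rate M T A n = w (Suc n)"
  by (simp add: wandering_rate_def hit_set_eq measure_visits_M)

lemma measure_hit_set: "measure M (hit_set M T A n) = w (Suc n)"
  by (simp add: hit_set_eq measure_visits_M)

lemma w_mono: "i \<le> j \<Longrightarrow> w i \<le> w j"
  unfolding w_def by (intro sum_mono2) auto

lemma noret_measure_antimono: "i \<le> j \<Longrightarrow> measure M (noret j) \<le> measure M (noret i)"
  using noret_antimono noret_fmeasurable by (intro measure_mono_fmeasurable) auto

lemma AE_visits: "AE x in M. \<forall>m. \<exists>n\<ge>m. (T ^^ n) x \<in> A"
  by (rule conservative_ergodic_recurrence[OF mp cons erg A_sets A_pos])

lemma incseq_hits: "incseq (\<lambda>n. visits n (Suc n))"
  unfolding hit_set_eq[symmetric] by (force simp: incseq_def hit_set_def intro: order_trans)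

lemma AE_hits: "AE x in M. x \<in> (\<Union>n. visits n (Suc n))"
  using AE_visits AE_space
proof eventually_elim
  case (elim x)
  then obtain n where "(T ^^ n) x \<in> A" by blast
  then have "x \<in> visits n (Suc n)" using elim by (auto simp: visits_def)
  then show ?case by blast
qed

lemma range_hits: "sets N = sets M \<Longrightarrow> range (\<lambda>n. visits n (Suc n)) \<subseteq> sets N"
  using visits_sets by blast

text \<open>By recurrence, the events of a visit up to time n exhaust a space of infinite measure up
  to a null set.\<close>

lemma w_at_top: "filterlim w at_top sequentially"
proof -
  have "emeasure M (\<Union>n. visits n (Suc n)) = emeasure M (space M)"
    using AE_hits AE_space by (intro emeasure_eq_AE) auto
  then have "(\<lambda>n. emeasure M (visits n (Suc n))) \<longlonglongrightarrow> \<infinity>"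
    using Lim_emeasure_incseq[OF range_hits[OF refl] incseq_hits] infinite_space by simp
  then have "(\<lambda>n. ennreal (w (Suc n))) \<longlonglongrightarrow> \<infinity>" by (simp add: emeasure_visits_M)
  then have "filterlim (\<lambda>n. w (Suc n)) at_top sequentially"
    by (simp add: ennreal_tendsto_top_eq_at_top)
  then show ?thesis by (rule filterlim_sequentially_Suc[THEN iffD1])
qed

lemma prob_hits:
  assumes "prob_space N" "sets N = sets M" "absolutely_continuous M N"
  shows "(\<lambda>n. measure N (visits n (Suc n))) \<longlonglongrightarrow> 1"
proof -
  interpret N: prob_space N by fact
  have "AE x in N. x \<in> (\<Union>n. visits n (Suc n))"
    using absolutely_continuous_AE[OF assms(2,3) AE_hits] .
  then have "measure N (\<Union>n. visits n (Suc n)) = 1"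
    using assms(2) by (intro N.prob_eq_1[THEN iffD2]) auto
  then show ?thesis
    using N.finite_Lim_measure_incseq[OF range_hits[OF assms(2)] incseq_hits] by simp
qed

text \<open>Lying in all these sets would mean no visit after time \<open>k\<close>, which
  recurrence excludes almost surely; continuity from above does the rest.\<close>

lemma prob_noret:
  assumes "prob_space N" "sets N = sets M" "absolutely_continuous M N"
  shows "(\<lambda>n. measure N (pre_iter M T k (noret n))) \<longlonglongrightarrow> 0"
proof -
  interpret N: prob_space N by fact
  have d: "decseq (\<lambda>n. pre_iter M T k (noret n))"
    using noret_antimono by (force simp: decseq_def pre_iter_def)
  have r: "range (\<lambda>n. pre_iter M T k (noret n)) \<subseteq> sets N"
    using pre_iter_sets[OF noret_sets] assms(2) by blast
  have "AE x in M. x \<notin> (\<Inter>n. pre_iter M T k (noret n))"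
    using AE_visits
  proof eventually_elim
    case (elim x)
    obtain n where n: "Suc k \<le> n" "(T ^^ n) x \<in> A" using elim by blast
    then have "(T ^^ (n - k)) ((T ^^ k) x) \<in> A"
      by (metis Suc_leD funpow_add le_add_diff_inverse2 o_apply)
    then have "x \<notin> pre_iter M T k (noret (n - k))" using n(1) by (auto simp: pre_iter_def noret_def)
    then show ?case by blast
  qed
  then have "AE x in N. x \<notin> (\<Inter>n. pre_iter M T k (noret n))"
    using absolutely_continuous_AE[OF assms(2,3)] by blast
  moreover have "(\<Inter>n. pre_iter M T k (noret n)) \<in> sets N"
    using r by (intro sets.countable_INT) auto
  ultimately have "measure N (\<Inter>n. pre_iter M T k (noret n)) = 0"
    using N.prob_eq_0 by blast
  then show ?thesis
    using N.finite_Lim_measure_decseq[OF r d] by simp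
qed

end

section \<open>Asymptotics of the return sequence\<close>

lemma tendsto_squeeze_factor:
  fixes x y z :: "nat \<Rightarrow> real"
  assumes x: "x \<longlonglongrightarrow> t" and y: "y \<longlonglongrightarrow> t"
    and z: "\<And>e. 0 < e \<Longrightarrow> e < 1 \<Longrightarrow> \<forall>\<^sub>F n in sequentially. (1 - e) * x n \<le> z n \<and> z n \<le> (1 + e) * y n"
  shows "z \<longlonglongrightarrow> t"
proof (rule order_tendstoI)
  have small: "\<forall>\<^sub>F e in at_right 0. (0::real) < e \<and> e < 1"
    by (auto simp: eventually_at_right[of 0 1] intro!: exI[of _ 1])
  {
    fix a assume a: "a < t"
    have "((\<lambda>e. (1 - e) * t) \<longlongrightarrow> (1 - 0) * t) (at_right 0)" by (intro tendsto_intros)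
    then have "\<forall>\<^sub>F e in at_right 0. a < (1 - e) * t" using a by (intro order_tendstoD) auto
    then obtain e where e: "0 < e" "e < 1" "a < (1 - e) * t"
      using eventually_happens'[OF trivial_limit_at_right_real, OF eventually_conj[OF small]] by auto
    have "(\<lambda>n. (1 - e) * x n) \<longlonglongrightarrow> (1 - e) * t" by (intro tendsto_intros x)
    then have "\<forall>\<^sub>F n in sequentially. a < (1 - e) * x n" using e by (intro order_tendstoD) auto
    then show "\<forall>\<^sub>F n in sequentially. a < z n" using z[OF e(1,2)] by eventually_elim auto
  next
    fix a assume a: "t < a"
    have "((\<lambda>e. (1 + e) * t) \<longlongrightarrow> (1 + 0) * t) (at_right 0)" by (intro tendsto_intros)
    then have "\<forall>\<^sub>F e in at_right 0. (1 + e) * t < a" using a by (intro order_tendstoD) auto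
    then obtain e where e: "0 < e" "e < 1" "(1 + e) * t < a"
      using eventually_happens'[OF trivial_limit_at_right_real, OF eventually_conj[OF small]] by auto
    have "(\<lambda>n. (1 + e) * y n) \<longlonglongrightarrow> (1 + e) * t" by (intro tendsto_intros y)
    then have "\<forall>\<^sub>F n in sequentially. (1 + e) * y n < a" using e by (intro order_tendstoD) auto
    then show "\<forall>\<^sub>F n in sequentially. z n < a" using z[OF e(1,2)] by eventually_elim auto
  }
qed

text \<open>\<open>returning\<close> is uniform return integrated over subsets of \<open>A\<close>.
  Its error is relative to \<open>measure M B\<close>, so one threshold \<open>K\<close> serves all
  the sets \<open>noret i\<close> and the errors can be summed.\<close>

locale slow_returning = recurrent_system +
  fixes \<nu> :: "'a measure" and b :: "nat \<Rightarrow> real"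
  assumes prob_nu: "prob_space \<nu>" and sets_nu[simp, measurable_cong]: "sets \<nu> = sets M"
    and ac_nu: "absolutely_continuous M \<nu>"
    and b_pos: "0 < b n" and b_mono: "incseq b"
    and returning: "0 < e \<Longrightarrow> \<exists>K. \<forall>k\<ge>K. \<forall>B\<in>sets M. B \<subseteq> A \<longrightarrow>
        \<bar>b k * measure \<nu> (pre_iter M T k B) - measure M B\<bar> \<le> e * measure M B"
    and slow: "slowly_varying_seq (wandering_rate M T A)"
begin

sublocale nu: prob_space \<nu> by (rule prob_nu)

text \<open>Slow variation is given for \<open>w (Suc n)\<close>. The factor 2c absorbs the index
  shift, since c (n + 1) <= 2 c n + 1 for n >= 1, and monotonicity gives the squeeze.\<close>

lemma w_mult_tendsto:
  assumes "1 \<le> c"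
  shows "(\<lambda>n. w (c * n) / w n) \<longlonglongrightarrow> 1"
proof -
  obtain L where L: "slowly_varying L" and u: "\<And>n. 1 \<le> n \<Longrightarrow> w (Suc n) = L (real n)"
    using slow by (auto simp: slowly_varying_seq_def wandering_rate_eq)
  have "((\<lambda>t. L (real (2 * c) * t) / L t) \<longlongrightarrow> 1) at_top"
    using L assms by (auto simp: slowly_varying_def)
  then have "(\<lambda>n. L (real (2 * c) * real n) / L (real n)) \<longlonglongrightarrow> 1"
    by (rule filterlim_compose[OF _ filterlim_real_sequentially])
  moreover have "\<forall>\<^sub>F n in sequentially. L (real (2 * c) * real n) / L (real n) = w (Suc (2 * c * n)) / w (Suc n)"
  proof (rule eventually_sequentiallyI[of 1])
    fix n :: nat assume "1 \<le> n"
    then have "1 \<le> 2 * c * n" using assms by simp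
    then show "L (real (2 * c) * real n) / L (real n) = w (Suc (2 * c * n)) / w (Suc n)"
      using u[OF \<open>1 \<le> n\<close>] u[of "2 * c * n"] by simp
  qed
  ultimately have up: "(\<lambda>n. w (Suc (2 * c * n)) / w (Suc n)) \<longlonglongrightarrow> 1"
    by (rule Lim_transform_eventually)
  have pos: "\<forall>\<^sub>F n in sequentially. 0 < w (Suc n)"
    using w_at_top by (subst eventually_sequentially_Suc) (simp add: filterlim_at_top_dense)
  have "(\<lambda>n. w (c * Suc n) / w (Suc n)) \<longlonglongrightarrow> 1"
  proof (rule tendsto_sandwich[OF _ _ tendsto_const up])
    show "\<forall>\<^sub>F n in sequentially. 1 \<le> w (c * Suc n) / w (Suc n)"
      using pos
    proof eventually_elim
      case (elim n)
      have "w (Suc n) \<le> w (c * Suc n)" using mult_le_mono1[OF assms, of "Suc n"] by (intro w_mono) simp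
      then show ?case using elim by simp
    qed
    show "\<forall>\<^sub>F n in sequentially. w (c * Suc n) / w (Suc n) \<le> w (Suc (2 * c * n)) / w (Suc n)"
      using pos eventually_ge_at_top[of 1]
    proof eventually_elim
      case (elim n)
      have "c * Suc n \<le> Suc (2 * c * n)"
        using mult_le_mono2[OF elim(2), of c] unfolding mult_Suc_right by linarith
      then have "w (c * Suc n) \<le> w (Suc (2 * c * n))" by (rule w_mono)
      then show ?case using elim by (intro divide_right_mono) auto
    qed
  qed
  then show ?thesis by (rule filterlim_sequentially_Suc[THEN iffD1])
qed

lemma w_pos_eventually: "filterlim m at_top F \<Longrightarrow> \<forall>\<^sub>F n in F. 0 < w (m n)"
  using filterlim_compose[OF w_at_top, of m F] by (simp add: filterlim_at_top_dense)

text \<open>Monotonicity squeezes the ratio between 1 and the one for \<open>c * m n\<close>. Time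
  sequences comparable up to a constant thus become interchangeable inside \<open>w\<close>.\<close>

lemma w_ratio_tendsto:
  assumes m: "filterlim m at_top sequentially"
    and le: "\<forall>\<^sub>F n in sequentially. m n \<le> k n \<and> k n \<le> c * m n"
  shows "(\<lambda>n. w (k n) / w (m n)) \<longlonglongrightarrow> 1"
proof -
  have c: "1 \<le> c"
  proof -
    have "\<forall>\<^sub>F n in sequentially. 1 \<le> m n" using m by (simp add: filterlim_at_top)
    with le have "\<forall>\<^sub>F n in sequentially. 1 \<le> c"
      by eventually_elim (cases c, auto)
    then show ?thesis by simp
  qed
  show ?thesis
  proof (rule tendsto_sandwich[OF _ _ tendsto_const filterlim_compose[OF w_mult_tendsto[OF c] m]])
    show "\<forall>\<^sub>F n in sequentially. 1 \<le> w (k n) / w (m n)"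
      using le w_pos_eventually[OF m] by eventually_elim (simp add: w_mono)
    show "\<forall>\<^sub>F n in sequentially. w (k n) / w (m n) \<le> w (c * m n) / w (m n)"
      using le w_pos_eventually[OF m] by eventually_elim (simp add: w_mono divide_right_mono)
  qed
qed

lemma measure_visits_nu:
  "j \<le> Suc m \<Longrightarrow> measure \<nu> (visits m j) = (\<Sum>i<j. measure \<nu> (pre_iter M T (m - i) (noret i)))"
  by (rule measure_visits[OF nu.finite_measure_axioms sets_nu])

text \<open>The visit times m - i in the last-visit decomposition lie between
  \<open>Suc m - j\<close> and \<open>m\<close>. All are at least \<open>K\<close>, so uniform
  return applies, and monotonicity of \<open>b\<close> replaces their factors by the extreme
  ones.\<close>

lemma visits_bounds:
  assumes K: "\<forall>k\<ge>K. \<forall>B\<in>sets M. B \<subseteq> A \<longrightarrow>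
        \<bar>b k * measure \<nu> (pre_iter M T k B) - measure M B\<bar> \<le> e * measure M B"
    and j: "j \<le> Suc m" "K \<le> Suc m - j"
  shows "(1 - e) * w j \<le> b m * measure \<nu> (visits m j)"
    "b (Suc m - j) * measure \<nu> (visits m j) \<le> (1 + e) * w j"
proof -
  have *: "(1 - e) * measure M (noret i) \<le> b (m - i) * measure \<nu> (pre_iter M T (m - i) (noret i))"
    "b (m - i) * measure \<nu> (pre_iter M T (m - i) (noret i)) \<le> (1 + e) * measure M (noret i)"
    if "i < j" for i
  proof -
    have "K \<le> m - i" using that j by simp
    then have "\<bar>b (m - i) * measure \<nu> (pre_iter M T (m - i) (noret i)) - measure M (noret i)\<bar>
        \<le> e * measure M (noret i)"
      using K noret_sets noret_subset by blast
    then show "(1 - e) * measure M (noret i) \<le> b (m - i) * measure \<nu> (pre_iter M T (m - i) (noret i))"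
      "b (m - i) * measure \<nu> (pre_iter M T (m - i) (noret i)) \<le> (1 + e) * measure M (noret i)"
      by (simp_all add: abs_le_iff algebra_simps)
  qed
  have "(1 - e) * w j = (\<Sum>i<j. (1 - e) * measure M (noret i))"
    by (simp add: w_def sum_distrib_left)
  also have "\<dots> \<le> (\<Sum>i<j. b m * measure \<nu> (pre_iter M T (m - i) (noret i)))"
  proof (intro sum_mono)
    fix i assume "i \<in> {..<j}"
    moreover have "b (m - i) \<le> b m" using b_mono by (simp add: incseq_def)
    ultimately show "(1 - e) * measure M (noret i) \<le> b m * measure \<nu> (pre_iter M T (m - i) (noret i))"
      using *(1)[of i] mult_right_mono[of "b (m - i)" "b m" "measure \<nu> (pre_iter M T (m - i) (noret i))"]
      by simp
  qed
  also have "\<dots> = b m * measure \<nu> (visits m j)"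
    using measure_visits_nu[OF j(1)] by (simp add: sum_distrib_left)
  finally show "(1 - e) * w j \<le> b m * measure \<nu> (visits m j)" .
  have "b (Suc m - j) * measure \<nu> (visits m j) =
      (\<Sum>i<j. b (Suc m - j) * measure \<nu> (pre_iter M T (m - i) (noret i)))"
    using measure_visits_nu[OF j(1)] by (simp add: sum_distrib_left)
  also have "\<dots> \<le> (\<Sum>i<j. (1 + e) * measure M (noret i))"
  proof (intro sum_mono)
    fix i assume i: "i \<in> {..<j}"
    then have "Suc m - j \<le> m - i" using j by simp
    then have "b (Suc m - j) \<le> b (m - i)" using b_mono by (simp add: incseq_def)
    then show "b (Suc m - j) * measure \<nu> (pre_iter M T (m - i) (noret i)) \<le> (1 + e) * measure M (noret i)"
      using i *(2)[of i] mult_right_mono[of "b (Suc m - j)" "b (m - i)" "measure \<nu> (pre_iter M T (m - i) (noret i))"]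
      by simp
  qed
  also have "\<dots> = (1 + e) * w j" by (simp add: w_def sum_distrib_left)
  finally show "b (Suc m - j) * measure \<nu> (visits m j) \<le> (1 + e) * w j" .
qed

text \<open>A window of length \<open>Suc n - K\<close> is the longest that avoids times before
  \<open>K\<close>. Its probability is at most 1, so \<open>b n\<close> nearly dominates
  \<open>w (Suc n - K)\<close>, which slow variation compares with \<open>w (Suc n)\<close>.\<close>

lemma b_lower:
  assumes "0 < e" "e < 1"
  shows "\<forall>\<^sub>F n in sequentially. 1 - e \<le> b n / w n"
proof -
  obtain K where K: "\<forall>k\<ge>K. \<forall>B\<in>sets M. B \<subseteq> A \<longrightarrow>
        \<bar>b k * measure \<nu> (pre_iter M T k B) - measure M B\<bar> \<le> e / 2 * measure M B"
    using returning[of "e / 2"] assms by auto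
  have m: "filterlim (\<lambda>n. Suc n - K) at_top sequentially"
    by (subst filterlim_sequentially_Suc[where f = "\<lambda>n. n - K"]) (rule filterlim_minus_const_nat_at_top)
  have "\<forall>\<^sub>F n in sequentially. Suc n - K \<le> Suc n \<and> Suc n \<le> 2 * (Suc n - K)"
    by (rule eventually_sequentiallyI[of "2 * K"]) auto
  then have "(\<lambda>n. w (Suc n) / w (Suc n - K)) \<longlonglongrightarrow> 1" by (rule w_ratio_tendsto[OF m])
  then have "(\<lambda>n. (1 - e / 2) * inverse (w (Suc n) / w (Suc n - K))) \<longlonglongrightarrow> (1 - e / 2) * inverse 1"
    by (intro tendsto_intros) auto
  then have "\<forall>\<^sub>F n in sequentially. 1 - e < (1 - e / 2) * inverse (w (Suc n) / w (Suc n - K))"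
    using assms by (intro order_tendstoD) auto
  moreover have "\<forall>\<^sub>F n in sequentially. 0 < w n" by (rule w_pos_eventually) (rule filterlim_ident)
  ultimately show ?thesis using eventually_ge_at_top[of "K"]
  proof eventually_elim
    case (elim n)
    have ws: "w n \<le> w (Suc n)" by (intro w_mono) simp
    have "(1 - e) * w n \<le> (1 - e) * w (Suc n)" using ws assms by (intro mult_left_mono) auto
    also have "\<dots> \<le> (1 - e / 2) * w (Suc n - K)"
      using elim(1,2) ws by (simp add: field_simps)
    also have "\<dots> \<le> b n * measure \<nu> (visits n (Suc n - K))"
      using elim(3) by (intro visits_bounds(1)[OF K]) auto
    also have "\<dots> \<le> b n * 1" using b_pos[of n] by (intro mult_left_mono) auto
    finally show ?case using elim(2) by (simp add: field_simps)
  qed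
qed

text \<open>For fixed n = k + i the terms are probabilities of disjoint events, namely that the last
  visit up to n happens at n - i, so they add up to at most 1. Only values n < 2m occur.\<close>

lemma sum_pre_iter_noret:
  "(\<Sum>k\<le>m. \<Sum>i<m. measure \<nu> (pre_iter M T k (noret i))) \<le> 2 * real m"
proof -
  define c where "c k i = measure \<nu> (pre_iter M T k (noret i))" for k i
  define g :: "nat \<times> nat \<Rightarrow> nat \<times> nat" where "g = (\<lambda>(k, i). (k + i, i))"
  have "(\<Sum>k\<le>m. \<Sum>i<m. c k i) = (\<Sum>(k, i)\<in>{..m} \<times> {..<m}. c k i)"
    by (simp add: sum.cartesian_product)
  also have "\<dots> = (\<Sum>(n, i)\<in>g ` ({..m} \<times> {..<m}). c (n - i) i)"
    by (rule sum.reindex_cong[symmetric, of g]) (auto simp: g_def inj_on_def)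
  also have "\<dots> \<le> (\<Sum>(n, i)\<in>Sigma {..<2 * m} (\<lambda>n. {..<Suc n}). c (n - i) i)"
    by (intro sum_mono2) (auto simp: g_def c_def)
  also have "\<dots> = (\<Sum>n<2 * m. \<Sum>i<Suc n. c (n - i) i)"
    by (subst sum.Sigma) auto
  also have "\<dots> = (\<Sum>n<2 * m. measure \<nu> (visits n (Suc n)))"
    unfolding c_def by (intro sum.cong refl measure_visits_nu[symmetric]) auto
  also have "\<dots> \<le> (\<Sum>n<2 * m. 1)" by (intro sum_mono) auto
  finally show ?thesis by (simp add: c_def)
qed

text \<open>The sum bounds the probability that the last visit up to time 3m happens no later than
  m, the part of a long window that \<open>b_upper\<close> has to discard.\<close>

lemma early_last_visit:
  "(\<lambda>m. \<Sum>k\<le>m. measure \<nu> (pre_iter M T k (noret (2 * m)))) \<longlonglongrightarrow> 0"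
proof -
  obtain K where K: "\<forall>k\<ge>K. \<forall>B\<in>sets M. B \<subseteq> A \<longrightarrow>
        \<bar>b k * measure \<nu> (pre_iter M T k B) - measure M B\<bar> \<le> 1 / 2 * measure M B"
    using returning[of "1 / 2"] by auto
  define c where "c k i = measure \<nu> (pre_iter M T k (noret i))" for k i
  have c0: "0 \<le> c k i" for k i by (simp add: c_def)
  have cK: "measure M (noret i) \<le> 2 * (b k * c k i)" "b k * c k i \<le> 3 / 2 * measure M (noret i)"
    if "K \<le> k" for k i
  proof -
    have "\<bar>b k * c k i - measure M (noret i)\<bar> \<le> 1 / 2 * measure M (noret i)"
      using K that noret_sets noret_subset unfolding c_def by blast
    then show "measure M (noret i) \<le> 2 * (b k * c k i)" "b k * c k i \<le> 3 / 2 * measure M (noret i)"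
      by linarith+
  qed
  \<comment> \<open>With q the measure of \<open>noret (2 * m)\<close>, each term is at most 3/2 q /
    b k, the reciprocals 1 / b k sum to at most 4 m / w m, and m q is at most
    \<open>w (2 * m) - w m\<close>. Slow variation makes the product vanish.\<close>
  have bound: "(\<Sum>k\<in>{K..m}. c k (2 * m)) \<le> 6 * (w (2 * m) / w m - 1)"
    if m: "0 < m" and wm: "0 < w m" for m
  proof -
    have q: "real m * measure M (noret (2 * m)) \<le> w (2 * m) - w m"
    proof -
      have "w (2 * m) - w m = (\<Sum>i\<in>{m..<2 * m}. measure M (noret i))"
        unfolding w_def lessThan_atLeast0 by (subst sum_diff_nat_ivl) auto
      also have "\<dots> \<ge> (\<Sum>i\<in>{m..<2 * m}. measure M (noret (2 * m)))"
        by (intro sum_mono noret_measure_antimono) auto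
      finally show ?thesis by simp
    qed
    \<comment> \<open>Uniform return bounds each \<open>measure M (noret i) / b k\<close> by twice a
      return probability, so \<open>sum_pre_iter_noret\<close> controls the double sum.\<close>
    have inv: "w m * (\<Sum>k\<in>{K..m}. 1 / b k) \<le> 4 * real m"
    proof -
      have "w m * (\<Sum>k\<in>{K..m}. 1 / b k) = (\<Sum>k\<in>{K..m}. \<Sum>i<m. measure M (noret i) / b k)"
        by (simp add: w_def sum_distrib_left sum_divide_distrib)
      also have "\<dots> \<le> (\<Sum>k\<in>{K..m}. \<Sum>i<m. 2 * c k i)"
        using cK(1) b_pos by (intro sum_mono) (simp add: field_simps)
      also have "\<dots> \<le> (\<Sum>k\<le>m. \<Sum>i<m. 2 * c k i)"
        using c0 by (intro sum_mono2 sum_nonneg) auto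
      also have "\<dots> = 2 * (\<Sum>k\<le>m. \<Sum>i<m. c k i)" by (simp add: sum_distrib_left)
      also have "\<dots> \<le> 2 * (2 * real m)"
        using sum_pre_iter_noret[of m] by (simp add: c_def)
      finally show ?thesis by simp
    qed
    have "(\<Sum>k\<in>{K..m}. c k (2 * m)) \<le> (\<Sum>k\<in>{K..m}. 3 / 2 * measure M (noret (2 * m)) * (1 / b k))"
      using cK(2)[of _ "2 * m"] b_pos by (intro sum_mono) (simp add: field_simps)
    also have "\<dots> = 3 / 2 * measure M (noret (2 * m)) * (\<Sum>k\<in>{K..m}. 1 / b k)"
      by (simp only: sum_distrib_left)
    also have "\<dots> \<le> 3 / 2 * measure M (noret (2 * m)) * (4 * real m / w m)"
      using inv wm by (intro mult_left_mono) (simp_all add: field_simps)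
    also have "\<dots> = 6 * (real m * measure M (noret (2 * m))) / w m" by simp
    also have "\<dots> \<le> 6 * (w (2 * m) - w m) / w m"
      using q wm by (intro divide_right_mono mult_left_mono) auto
    also have "\<dots> = 6 * (w (2 * m) / w m - 1)" using wm by (simp add: field_simps)
    finally show ?thesis .
  qed
  have twice: "filterlim (\<lambda>m::nat. 2 * m) at_top sequentially"
    by (rule filterlim_subseq) (simp add: strict_mono_def)
  \<comment> \<open>The times before \<open>K\<close>, to which the uniform estimate does not apply,
    are finitely many and their terms vanish one by one.\<close>
  have "(\<lambda>m. c k (2 * m)) \<longlonglongrightarrow> 0" for k
    unfolding c_def
    by (rule filterlim_compose[OF prob_noret[OF prob_nu sets_nu ac_nu] twice])
  then have first: "(\<lambda>m. \<Sum>k<K. c k (2 * m)) \<longlonglongrightarrow> (\<Sum>k<K. 0)"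
    by (intro tendsto_sum) auto
  have "(\<lambda>m. (\<Sum>k<K. c k (2 * m)) + 6 * (w (2 * m) / w m - 1)) \<longlonglongrightarrow> (\<Sum>k<K. 0) + 6 * (1 - 1)"
    by (intro tendsto_intros first w_mult_tendsto) simp
  then have up: "(\<lambda>m. (\<Sum>k<K. c k (2 * m)) + 6 * (w (2 * m) / w m - 1)) \<longlonglongrightarrow> 0" by simp
  have "(\<lambda>m. \<Sum>k\<le>m. c k (2 * m)) \<longlonglongrightarrow> 0"
  proof (rule tendsto_sandwich[OF _ _ tendsto_const up])
    show "\<forall>\<^sub>F m in sequentially. 0 \<le> (\<Sum>k\<le>m. c k (2 * m))"
      using c0 by (intro always_eventually allI sum_nonneg) auto
    have "\<forall>\<^sub>F n in sequentially. 0 < w n" by (rule w_pos_eventually) (rule filterlim_ident)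
    then show "\<forall>\<^sub>F m in sequentially. (\<Sum>k\<le>m. c k (2 * m)) \<le> (\<Sum>k<K. c k (2 * m)) + 6 * (w (2 * m) / w m - 1)"
      using eventually_gt_at_top[of 0]
    proof eventually_elim
      case (elim m)
      have "(\<Sum>k\<le>m. c k (2 * m)) \<le> (\<Sum>k\<in>{..<K} \<union> {K..m}. c k (2 * m))"
        using c0 by (intro sum_mono2) auto
      also have "\<dots> = (\<Sum>k<K. c k (2 * m)) + (\<Sum>k\<in>{K..m}. c k (2 * m))"
        by (intro sum.union_disjoint) auto
      finally show ?case using bound[OF elim(2,1)] by simp
    qed
  qed
  then show ?thesis by (simp add: c_def)
qed

text \<open>A visit during (m, 3m] has probability tending to 1, by \<open>prob_hits\<close> and
  \<open>early_last_visit\<close>. It is also at most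
  \<open>(1 + e / 2) * w (2 * m) / b (Suc m)\<close>, and \<open>w (2 * m)\<close> is asymptotic to
  \<open>w m\<close>.\<close>

lemma b_upper:
  assumes "0 < e" "e < 1"
  shows "\<forall>\<^sub>F n in sequentially. b n / w n \<le> 1 + e"
proof -
  obtain K where K: "\<forall>k\<ge>K. \<forall>B\<in>sets M. B \<subseteq> A \<longrightarrow>
        \<bar>b k * measure \<nu> (pre_iter M T k B) - measure M B\<bar> \<le> e / 2 * measure M B"
    using returning[of "e / 2"] assms by auto
  define R where "R m = (\<Sum>k\<le>m. measure \<nu> (pre_iter M T k (noret (2 * m))))" for m
  define p where "p m = measure \<nu> (visits (3 * m) (Suc (3 * m))) - R m" for m
  have thrice: "filterlim (\<lambda>m::nat. 3 * m) at_top sequentially"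
    by (rule filterlim_subseq) (simp add: strict_mono_def)
  have "p \<longlonglongrightarrow> 1 - 0" unfolding p_def R_def
    by (intro tendsto_diff early_last_visit filterlim_compose[OF prob_hits[OF prob_nu sets_nu ac_nu] thrice])
  then have p: "p \<longlonglongrightarrow> 1" by simp
  have split: "p m \<le> measure \<nu> (visits (3 * m) (2 * m))" for m
  proof -
    have ivl: "{..<Suc (3 * m)} = {..<2 * m} \<union> {2 * m..3 * m}" by auto
    have "measure \<nu> (visits (3 * m) (Suc (3 * m))) =
      (\<Sum>i\<in>{..<2 * m} \<union> {2 * m..3 * m}. measure \<nu> (pre_iter M T (3 * m - i) (noret i)))"
      by (subst measure_visits_nu, simp) (simp only: ivl)
    also have "\<dots> = measure \<nu> (visits (3 * m) (2 * m)) +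
        (\<Sum>i\<in>{2 * m..3 * m}. measure \<nu> (pre_iter M T (3 * m - i) (noret i)))"
      by (subst sum.union_disjoint) (auto simp: measure_visits_nu)
    \<comment> \<open>For these \<open>i\<close> the set \<open>noret i\<close> lies in
      \<open>noret (2 * m)\<close>; substituting k = 3m - i then produces
      \<open>R m\<close>.\<close>
    also have "(\<Sum>i\<in>{2 * m..3 * m}. measure \<nu> (pre_iter M T (3 * m - i) (noret i))) \<le>
        (\<Sum>i\<in>{2 * m..3 * m}. measure \<nu> (pre_iter M T (3 * m - i) (noret (2 * m))))"
      using noret_antimono
      by (intro sum_mono nu.finite_measure_mono)
        (auto simp: pre_iter_sets subset_iff pre_iter_def[of M T _ "noret _"] pre_iter_sets[unfolded pre_iter_def])
    also have "\<dots> = R m"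
      unfolding R_def
      by (rule sum.reindex_bij_witness[where i = "\<lambda>k. 3 * m - k" and j = "\<lambda>i. 3 * m - i"]) auto
    finally show ?thesis by (simp add: p_def)
  qed
  have "(\<lambda>m. (1 + e / 2) * (w (2 * m) / w m) / p m) \<longlonglongrightarrow> (1 + e / 2) * 1 / 1"
    by (intro tendsto_intros w_mult_tendsto p) auto
  then have "\<forall>\<^sub>F m in sequentially. (1 + e / 2) * (w (2 * m) / w m) / p m < 1 + e"
    using assms by (intro order_tendstoD) auto
  moreover have "\<forall>\<^sub>F m in sequentially. 0 < p m" using p by (intro order_tendstoD) auto
  moreover have "\<forall>\<^sub>F n in sequentially. 0 < w n" by (rule w_pos_eventually) (rule filterlim_ident)
  ultimately show ?thesis using eventually_ge_at_top[of "K"]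
  proof eventually_elim
    case (elim m)
    have "b m * p m \<le> b (Suc m) * measure \<nu> (visits (3 * m) (2 * m))"
      using b_mono b_pos[of "Suc m"] split[of m] elim(2) by (intro mult_mono) (auto simp: incseq_def)
    also have "Suc m = Suc (3 * m) - 2 * m" by simp
    also have "b \<dots> * measure \<nu> (visits (3 * m) (2 * m)) \<le> (1 + e / 2) * w (2 * m)"
      using elim(4) by (intro visits_bounds(2)[OF K]) auto
    finally have "b m / w m \<le> (1 + e / 2) * (w (2 * m) / w m) / p m"
      using elim(2,3) by (simp add: field_simps)
    then show ?case using elim(1) by simp
  qed
qed

lemma b_asymp: "(\<lambda>n. b n / w n) \<longlonglongrightarrow> 1"
proof (rule tendsto_squeeze_factor[OF tendsto_const tendsto_const])
  fix e :: real assume "0 < e" "e < 1"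
  then show "\<forall>\<^sub>F n in sequentially. (1 - e) * 1 \<le> b n / w n \<and> b n / w n \<le> (1 + e) * 1"
    using b_lower b_upper by (simp add: eventually_conj_iff)
qed

text \<open>As \<open>j n\<close> is at most half of \<open>m n\<close>, the time \<open>k n\<close>
  stays comparable to \<open>m n\<close>. By \<open>b_asymp\<close> and slow variation both bounds
  of \<open>visits_bounds\<close> then have denominators asymptotic to
  \<open>w (m n)\<close>.\<close>

lemma visits_tendsto_nu:
  assumes m: "filterlim m at_top sequentially"
    and le: "\<forall>\<^sub>F n in sequentially. 2 * j n \<le> m n"
    and t: "(\<lambda>n. w (j n) / w (m n)) \<longlonglongrightarrow> t"
  shows "(\<lambda>n. measure \<nu> (visits (m n) (j n))) \<longlonglongrightarrow> t"
proof -
  define k where "k n = Suc (m n) - j n" for n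
  have k: "filterlim k at_top sequentially"
    unfolding filterlim_at_top
  proof
    fix Z
    have "\<forall>\<^sub>F n in sequentially. 2 * Z \<le> m n" using m by (simp add: filterlim_at_top)
    then show "\<forall>\<^sub>F n in sequentially. Z \<le> k n"
      using le by eventually_elim (simp add: k_def)
  qed
  have wm: "\<forall>\<^sub>F n in sequentially. 0 < w (m n)" by (rule w_pos_eventually[OF m])
  have wk: "\<forall>\<^sub>F n in sequentially. 0 < w (k n)" by (rule w_pos_eventually[OF k])
  have "(\<lambda>n. w (j n) / w (m n) * inverse (b (m n) / w (m n))) \<longlonglongrightarrow> t * inverse 1"
    by (intro tendsto_intros t filterlim_compose[OF b_asymp m]) simp
  moreover have "\<forall>\<^sub>F n in sequentially. w (j n) / w (m n) * inverse (b (m n) / w (m n)) = w (j n) / b (m n)"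
    using wm by eventually_elim (simp add: field_simps)
  ultimately have x: "(\<lambda>n. w (j n) / b (m n)) \<longlonglongrightarrow> t"
    by (auto intro: Lim_transform_eventually)
  \<comment> \<open>\<open>k n\<close> equals \<open>Suc (m n)\<close> when \<open>j n\<close> is 0,
    hence the detour through \<open>w (Suc (m n))\<close>.\<close>
  have "(\<lambda>n. w (Suc (m n)) / w (k n)) \<longlonglongrightarrow> 1"
  proof (rule w_ratio_tendsto[OF k])
    show "\<forall>\<^sub>F n in sequentially. k n \<le> Suc (m n) \<and> Suc (m n) \<le> 2 * k n"
      using le by eventually_elim (simp add: k_def)
  qed
  moreover have "(\<lambda>n. w (Suc (m n)) / w (m n)) \<longlonglongrightarrow> 1"
  proof (rule w_ratio_tendsto[OF m])
    have "\<forall>\<^sub>F n in sequentially. 1 \<le> m n" using m by (simp add: filterlim_at_top)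
    then show "\<forall>\<^sub>F n in sequentially. m n \<le> Suc (m n) \<and> Suc (m n) \<le> 2 * m n"
      by eventually_elim simp
  qed
  ultimately have "(\<lambda>n. w (j n) / w (m n) * inverse (w (Suc (m n)) / w (m n)) * (w (Suc (m n)) / w (k n)) *
      inverse (b (k n) / w (k n))) \<longlonglongrightarrow> t * inverse 1 * 1 * inverse 1"
    by (intro tendsto_intros t filterlim_compose[OF b_asymp k]) simp_all
  moreover have "\<forall>\<^sub>F n in sequentially. w (j n) / w (m n) * inverse (w (Suc (m n)) / w (m n)) *
      (w (Suc (m n)) / w (k n)) * inverse (b (k n) / w (k n)) = w (j n) / b (k n)"
    using wm wk
  proof eventually_elim
    case (elim n)
    have "w (m n) \<le> w (Suc (m n))" by (intro w_mono) simp
    then show ?case using elim b_pos[of "k n"] by (simp add: field_simps)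
  qed
  ultimately have y: "(\<lambda>n. w (j n) / b (k n)) \<longlonglongrightarrow> t"
    by (auto intro: Lim_transform_eventually)
  show ?thesis
  proof (rule tendsto_squeeze_factor[OF x y])
    fix e :: real assume "0 < e" "e < 1"
    obtain K where K: "\<forall>k\<ge>K. \<forall>B\<in>sets M. B \<subseteq> A \<longrightarrow>
        \<bar>b k * measure \<nu> (pre_iter M T k B) - measure M B\<bar> \<le> e * measure M B"
      using returning[OF \<open>0 < e\<close>] by auto
    have "\<forall>\<^sub>F n in sequentially. K \<le> k n" using k by (simp add: filterlim_at_top)
    then show "\<forall>\<^sub>F n in sequentially. (1 - e) * (w (j n) / b (m n)) \<le> measure \<nu> (visits (m n) (j n)) \<and>
        measure \<nu> (visits (m n) (j n)) \<le> (1 + e) * (w (j n) / b (k n))"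
      using le
    proof eventually_elim
      case (elim n)
      have "j n \<le> Suc (m n)" using elim(2) by simp
      from visits_bounds[OF K this elim(1)[unfolded k_def]] show ?case
        using b_pos[of "m n"] b_pos[of "k n"] by (simp add: k_def[symmetric] field_simps)
    qed
  qed
qed

end

section \<open>Convergence in law\<close>

context slow_returning
begin

text \<open>The weights spread \<open>\<nu>\<close> along its orbit under \<open>T\<close>, which makes it equivalent to \<open>M\<close> and
  keeps the property that late visits to \<open>A\<close> at a fixed time are unlikely.\<close>

definition spread :: "'a measure" where
  "spread = measure_pmf (geometric_pmf (1 / 2)) \<bind> (\<lambda>k. distr \<nu> M (T ^^ k))"

lemma spread_kernel:
  "(\<lambda>k. distr \<nu> M (T ^^ k)) \<in> measurable (measure_pmf (geometric_pmf (1 / 2))) (subprob_algebra M)"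
  by (auto simp: space_subprob_algebra intro!: prob_space_imp_subprob_space nu.prob_space_distr)

lemma sets_spread[simp, measurable_cong]: "sets spread = sets M"
  unfolding spread_def by (subst sets_bind) auto

lemma space_spread[simp]: "space spread = space M"
  by (rule sets_eq_imp_space_eq) simp

lemma space_nu[simp]: "space \<nu> = space M"
  by (rule sets_eq_imp_space_eq) simp

lemma prob_spread: "prob_space spread"
  unfolding spread_def
  by (rule measure_pmf.prob_space_bind[OF _ spread_kernel])
    (auto intro!: nu.prob_space_distr always_eventually)

lemma emeasure_spread:
  assumes "B \<in> sets M"
  shows "emeasure spread B = (\<integral>\<^sup>+k. emeasure \<nu> (pre_iter M T k B) \<partial>measure_pmf (geometric_pmf (1 / 2)))"
  unfolding spread_def
  by (subst emeasure_bind[OF _ spread_kernel assms])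
    (auto simp: emeasure_distr assms pre_iter_def)

lemma measure_spread:
  assumes "B \<in> sets M"
  shows "measure spread B = (\<integral>k. measure \<nu> (pre_iter M T k B) \<partial>measure_pmf (geometric_pmf (1 / 2)))"
  unfolding spread_def
  by (subst subprob_space.measure_bind[OF _ spread_kernel assms])
    (auto simp: measure_distr assms pre_iter_def intro!: prob_space_imp_subprob_space measure_pmf.prob_space_axioms)

text \<open>A set of positive \<open>M\<close>-measure is visited by almost every orbit under
  \<open>M\<close>, hence under \<nu>, so one of its preimages has positive \<nu>-measure; every
  preimage has positive weight in \<open>spread\<close>.\<close>

lemma null_sets_spread: "null_sets spread = null_sets M"
proof -
  have "emeasure spread B = 0 \<longleftrightarrow> emeasure M B = 0" if B: "B \<in> sets M" for B
  proof -
    have "emeasure spread B = 0 \<longleftrightarrow> (\<forall>k. emeasure \<nu> (pre_iter M T k B) = 0)"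
      unfolding emeasure_spread[OF B]
      by (subst nn_integral_0_iff_AE) (auto simp: AE_measure_pmf_iff set_pmf_geometric)
    also have "\<dots> \<longleftrightarrow> emeasure M B = 0"
    proof
      assume "emeasure M B = 0"
      then have "pre_iter M T k B \<in> null_sets M" for k
        using null_sets_pre_iter[OF mp] B by blast
      then show "\<forall>k. emeasure \<nu> (pre_iter M T k B) = 0"
        using ac_nu by (auto simp: absolutely_continuous_def)
    next
      assume "\<forall>k. emeasure \<nu> (pre_iter M T k B) = 0"
      then have "AE x in \<nu>. \<forall>k. x \<notin> pre_iter M T k B"
        unfolding AE_all_countable
        by (intro allI AE_not_in) (auto simp: null_sets_def pre_iter_sets B)
      then have never: "AE x in \<nu>. \<forall>k. (T ^^ k) x \<notin> B"
        using AE_space by eventually_elim (simp add: pre_iter_def)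
      show "emeasure M B = 0"
      proof (rule ccontr)
        assume "emeasure M B \<noteq> 0"
        then have "AE x in M. \<forall>m. \<exists>n\<ge>m. (T ^^ n) x \<in> B"
          by (intro conservative_ergodic_recurrence[OF mp cons erg B]) (simp add: zero_less_iff_neq_zero)
        then have "AE x in \<nu>. \<forall>m. \<exists>n\<ge>m. (T ^^ n) x \<in> B"
          using absolutely_continuous_AE[OF sets_nu ac_nu] by blast
        then have "AE x in \<nu>. False" using never by eventually_elim blast
        then show False by (simp add: nu.AE_False)
      qed
    qed
    finally show ?thesis .
  qed
  then show ?thesis by (auto simp: null_sets_def)
qed

lemma spread_nonsingular: "B \<in> null_sets spread \<Longrightarrow> T -` B \<inter> space spread \<in> null_sets spread"
  using null_sets_pre_iter[OF mp, of B 1] by (simp add: null_sets_spread pre_iter_def)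

lemma ergodic_spread: "ergodic spread T"
  unfolding ergodic_def
proof (intro ballI impI)
  fix B assume B: "B \<in> sets spread" "T -` B \<inter> space spread = B"
  then have "B \<in> null_sets M \<or> space M - B \<in> null_sets M"
    using erg by (auto simp: ergodic_def null_sets_def)
  then show "emeasure spread B = 0 \<or> emeasure spread (space spread - B) = 0"
    unfolding null_sets_spread[symmetric] by auto
qed

text \<open>This is a window of length 1, and \<open>w 1 / w n\<close> tends to 0 because
  \<open>w\<close> is unbounded.\<close>

lemma nu_hit_tendsto: "(\<lambda>n. measure \<nu> (pre_iter M T n A)) \<longlonglongrightarrow> 0"
proof -
  have "(\<lambda>n. measure \<nu> (visits n 1)) \<longlonglongrightarrow> 0"
  proof (rule visits_tendsto_nu[OF filterlim_ident])
    show "\<forall>\<^sub>F n in sequentially. 2 * 1 \<le> (n :: nat)" by simp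
    show "(\<lambda>n. w 1 / w n) \<longlonglongrightarrow> 0"
      by (rule tendsto_divide_0[OF tendsto_const filterlim_at_top_imp_at_infinity[OF w_at_top]])
  qed
  moreover have "visits n 1 = pre_iter M T n A" for n
    by (auto simp: visits_def pre_iter_def)
  ultimately show ?thesis by simp
qed

text \<open>Under \<open>spread\<close> a visit at time n averages visits under \<nu> at the times n
  + k. Each term vanishes, and dominated convergence in k applies.\<close>

lemma spread_hit_tendsto: "(\<lambda>n. measure spread (pre_iter M T n A)) \<longlonglongrightarrow> 0"
proof -
  have "pre_iter M T k (pre_iter M T n A) = pre_iter M T (n + k) A" for n k
    using measurable_space[OF T_pow_meas] by (auto simp: pre_iter_def funpow_add)
  then have eq: "measure spread (pre_iter M T n A) =
      (\<integral>k. measure \<nu> (pre_iter M T (n + k) A) \<partial>measure_pmf (geometric_pmf (1 / 2)))" for n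
    by (simp add: measure_spread pre_iter_sets)
  have "(\<lambda>n. \<integral>k. measure \<nu> (pre_iter M T (n + k) A) \<partial>measure_pmf (geometric_pmf (1 / 2)))
      \<longlonglongrightarrow> (\<integral>k. 0 \<partial>measure_pmf (geometric_pmf (1 / 2)))"
    by (rule integral_dominated_convergence[where w = "\<lambda>_. 1"])
      (auto intro!: always_eventually LIMSEQ_ignore_initial_segment nu_hit_tendsto)
  then show ?thesis by (simp add: eq)
qed

text \<open>Pulling back by \<open>T\<close> moves the window one step later. The two windows share
  all times except \<open>Suc m\<close> and \<open>Suc m - j\<close>.\<close>

lemma visits_shift:
  assumes "j \<le> m"
  shows "sym_diff (T -` visits m j \<inter> space M) (visits m j) \<subseteq>
    pre_iter M T (Suc m) A \<union> pre_iter M T (Suc m - j) A"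
proof
  fix x assume x: "x \<in> sym_diff (T -` visits m j \<inter> space M) (visits m j)"
  then have xs: "x \<in> space M" by (auto simp: visits_def)
  have "x \<in> T -` visits m j \<longleftrightarrow> (\<exists>i<j. (T ^^ (Suc m - i)) x \<in> A)"
  proof -
    have "(T ^^ (m - i)) (T x) = (T ^^ (Suc m - i)) x" if "i < j" for i
      using that assms by (simp add: Suc_diff_le funpow_swap1)
    then show ?thesis using xs measurable_space[OF T_meas xs] by (auto simp: visits_def)
  qed
  moreover have "x \<in> visits m j \<longleftrightarrow> (\<exists>i<j. (T ^^ (m - i)) x \<in> A)"
    using xs by (auto simp: visits_def)
  ultimately consider
    i where "i < j" "(T ^^ (Suc m - i)) x \<in> A" "\<forall>i<j. (T ^^ (m - i)) x \<notin> A" |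
    i where "i < j" "(T ^^ (m - i)) x \<in> A" "\<forall>i<j. (T ^^ (Suc m - i)) x \<notin> A"
    using x xs by auto
  then show "x \<in> pre_iter M T (Suc m) A \<union> pre_iter M T (Suc m - j) A"
  proof cases
    case 1
    have "i = 0"
    proof (rule ccontr)
      assume "i \<noteq> 0"
      then have "Suc m - i = m - (i - 1)" "i - 1 < j" using 1(1) by auto
      with 1 show False by metis
    qed
    with 1 xs show ?thesis by (auto simp: pre_iter_def)
  next
    case 2
    have "Suc i = j"
    proof (rule ccontr)
      assume "Suc i \<noteq> j"
      then have "Suc i < j" "m - i = Suc m - Suc i" using 2(1) by auto
      with 2 show False by metis
    qed
    then have "m - i = Suc m - j" by auto
    with 2 xs show ?thesis by (auto simp: pre_iter_def)
  qed
qed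

text \<open>Both boundary times in \<open>visits_shift\<close> tend to infinity, so the events are
  asymptotically invariant under \<open>spread\<close> and the limit for \<nu> carries over to
  \<open>N\<close>.\<close>

lemma visits_tendsto:
  assumes N: "prob_space N" "sets N = sets M" "absolutely_continuous M N"
    and m: "filterlim m at_top sequentially"
    and le: "\<forall>\<^sub>F n in sequentially. 2 * j n \<le> m n"
    and t: "(\<lambda>n. w (j n) / w (m n)) \<longlonglongrightarrow> t"
  shows "(\<lambda>n. measure N (visits (m n) (j n))) \<longlonglongrightarrow> t"
proof -
  interpret P: prob_space spread by (rule prob_spread)
  have k: "filterlim (\<lambda>n. Suc (m n) - j n) at_top sequentially"
    unfolding filterlim_at_top
  proof
    fix Z
    have "\<forall>\<^sub>F n in sequentially. 2 * Z \<le> m n" using m by (simp add: filterlim_at_top)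
    then show "\<forall>\<^sub>F n in sequentially. Z \<le> Suc (m n) - j n"
      using le by eventually_elim simp
  qed
  have m': "filterlim (\<lambda>n. Suc (m n)) at_top sequentially"
    using filterlim_compose[OF filterlim_Suc m] .
  have "(\<lambda>n. measure spread (pre_iter M T (Suc (m n)) A) + measure spread (pre_iter M T (Suc (m n) - j n) A))
      \<longlonglongrightarrow> 0 + 0"
    by (intro tendsto_add filterlim_compose[OF spread_hit_tendsto] k m')
  then have up: "(\<lambda>n. measure spread (pre_iter M T (Suc (m n)) A) + measure spread (pre_iter M T (Suc (m n) - j n) A))
      \<longlonglongrightarrow> 0" by simp
  have inv: "(\<lambda>n. measure spread (sym_diff (T -` visits (m n) (j n) \<inter> space spread) (visits (m n) (j n)))) \<longlonglongrightarrow> 0"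
  proof (rule tendsto_sandwich[OF _ _ tendsto_const up])
    show "\<forall>\<^sub>F n in sequentially. measure spread (sym_diff (T -` visits (m n) (j n) \<inter> space spread) (visits (m n) (j n)))
      \<le> measure spread (pre_iter M T (Suc (m n)) A) + measure spread (pre_iter M T (Suc (m n) - j n) A)"
      using le
    proof eventually_elim
      case (elim n)
      have "measure spread (sym_diff (T -` visits (m n) (j n) \<inter> space spread) (visits (m n) (j n))) \<le>
          measure spread (pre_iter M T (Suc (m n)) A \<union> pre_iter M T (Suc (m n) - j n) A)"
        using visits_shift[of "j n" "m n"] elim
        by (intro P.finite_measure_mono) (auto simp: pre_iter_sets)
      also have "\<dots> \<le> measure spread (pre_iter M T (Suc (m n)) A) + measure spread (pre_iter M T (Suc (m n) - j n) A)"
        by (intro measure_Un_le) (auto simp: pre_iter_sets)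
      finally show ?case .
    qed
  qed simp
  have Ts: "T \<in> measurable spread spread" by measurable
  have ac: "absolutely_continuous spread N'" if "absolutely_continuous M N'" for N'
    using that by (simp add: absolutely_continuous_def null_sets_spread)
  show ?thesis
    by (rule asymptotically_invariant_events[OF prob_spread Ts spread_nonsingular ergodic_spread
        prob_nu _ ac[OF ac_nu] N(1) _ ac[OF N(3)] _ inv visits_tendsto_nu[OF m le t]])
      (simp_all add: N(2) visits_sets)
qed

text \<open>A generalized inverse of \<open>w\<close>: for t < 1,
  \<open>w (Suc i) \<le> t * w (Suc n)\<close> holds exactly when \<open>i < cutoff t n\<close>.
  Hence \<open>Delta_proc M T A n x \<le> t\<close> says that \<open>Y_proc T A n x - n\<close> is
  below the cutoff.\<close>

definition cutoff :: "real \<Rightarrow> nat \<Rightarrow> nat" where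
  "cutoff t n = (LEAST i. t * w (Suc n) < w (Suc i))"

lemma w_Suc_pos: "0 < w (Suc n)"
proof -
  have "0 < measure M A" using A_pos A_fin by (simp add: measure_def enn2real_positive_iff)
  also have "measure M A = w 1" by (simp add: w_def noret_def)
  also have "w 1 \<le> w (Suc n)" by (intro w_mono) simp
  finally show ?thesis .
qed

lemma cutoff_upper:
  assumes "t < 1"
  shows "t * w (Suc n) < w (Suc (cutoff t n))"
  unfolding cutoff_def
proof (rule LeastI)
  \<comment> \<open>The index \<open>n\<close> itself satisfies the condition, so the
    \<open>LEAST\<close> is attained.\<close>
  show "t * w (Suc n) < w (Suc n)" using assms w_Suc_pos[of n] by simp
qed

lemma cutoff_lower:
  assumes "0 < t"
  shows "w (cutoff t n) \<le> t * w (Suc n)"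
proof (cases "cutoff t n")
  case 0
  then show ?thesis using assms w_Suc_pos[of n] by (simp add: w_def[of 0])
next
  case (Suc i)
  then have "i < cutoff t n" by simp
  from not_less_Least[OF this[unfolded cutoff_def]] show ?thesis by (simp add: Suc)
qed

lemma w_Suc_at_top: "filterlim (\<lambda>n. w (Suc n)) at_top sequentially"
  by (rule filterlim_compose[OF w_at_top filterlim_Suc])

lemma cutoff_at_top:
  assumes "0 < t" "t < 1"
  shows "filterlim (cutoff t) at_top sequentially"
  unfolding filterlim_at_top
proof
  fix Z
  have "\<forall>\<^sub>F n in sequentially. w (Suc Z) / t \<le> w (Suc n)"
    using w_Suc_at_top by (simp add: filterlim_at_top)
  then show "\<forall>\<^sub>F n in sequentially. Z \<le> cutoff t n"
  proof eventually_elim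
    case (elim n)
    show ?case
    proof (rule ccontr)
      assume "\<not> Z \<le> cutoff t n"
      then have "w (Suc (cutoff t n)) \<le> w (Suc Z)" by (intro w_mono) simp
      also have "\<dots> \<le> t * w (Suc n)" using elim assms by (simp add: field_simps)
      finally show False using cutoff_upper[OF assms(2), of n] by simp
    qed
  qed
qed

text \<open>By slow variation \<open>w\<close> at a fixed fraction of n already exceeds
  \<open>t * w (Suc n)\<close>. The factor 8 leaves room for windows of twice the cutoff, whose
  length must be at most half of their end time.\<close>

lemma cutoff_small:
  assumes "0 < t" "t < 1"
  shows "\<forall>\<^sub>F n in sequentially. 8 * cutoff t n \<le> n"
proof -
  have d: "filterlim (\<lambda>n::nat. n div 8) at_top sequentially"
    by (rule filterlim_at_top_div_const_nat) simp
  have "(\<lambda>n. w (Suc n) / w (n div 8)) \<longlonglongrightarrow> 1"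
  proof (rule w_ratio_tendsto[OF d], rule eventually_sequentiallyI[of 8])
    fix n :: nat assume "8 \<le> n"
    then have "1 \<le> n div 8" by simp
    moreover have "n = 8 * (n div 8) + n mod 8" "n mod 8 < 8" by simp_all
    ultimately show "n div 8 \<le> Suc n \<and> Suc n \<le> 16 * (n div 8)" by linarith
  qed
  then have "\<forall>\<^sub>F n in sequentially. w (Suc n) / w (n div 8) < 1 / t"
    using assms by (intro order_tendstoD) auto
  moreover have "\<forall>\<^sub>F n in sequentially. 0 < w (n div 8)" by (rule w_pos_eventually[OF d])
  ultimately show ?thesis
  proof eventually_elim
    case (elim n)
    then have "t * w (Suc n) < w (n div 8)" using assms by (simp add: field_simps)
    also have "\<dots> \<le> w (Suc (n div 8))" by (intro w_mono) simp
    finally have "cutoff t n \<le> n div 8" unfolding cutoff_def by (rule Least_le)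
    then show ?case by simp
  qed
qed

text \<open>Increments of \<open>w\<close> are at most \<open>w 1\<close>, the measure of
  \<open>A\<close>, which is negligible against \<open>w (Suc n)\<close>.\<close>

lemma w_cutoff_tendsto:
  assumes "0 < t" "t < 1"
  shows "(\<lambda>n. w (cutoff t n) / w (Suc n)) \<longlonglongrightarrow> t"
proof (rule tendsto_sandwich[OF _ _ _ tendsto_const])
  have "(\<lambda>n. t - w 1 / w (Suc n)) \<longlonglongrightarrow> t - 0"
    by (intro tendsto_diff tendsto_const tendsto_divide_0[OF tendsto_const]
        filterlim_at_top_imp_at_infinity w_Suc_at_top)
  then show "(\<lambda>n. t - w 1 / w (Suc n)) \<longlonglongrightarrow> t" by simp
  show "\<forall>\<^sub>F n in sequentially. t - w 1 / w (Suc n) \<le> w (cutoff t n) / w (Suc n)"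
  proof (intro always_eventually allI)
    fix n
    have "w (Suc (cutoff t n)) = w (cutoff t n) + measure M (noret (cutoff t n))" by (simp add: w_def)
    moreover have "measure M (noret (cutoff t n)) \<le> w 1"
      using noret_measure_antimono[of 0 "cutoff t n"] by (simp add: w_def)
    ultimately have "t * w (Suc n) \<le> w (cutoff t n) + w 1"
      using cutoff_upper[OF assms(2), of n] by simp
    then have "t \<le> (w (cutoff t n) + w 1) / w (Suc n)"
      using w_Suc_pos[of n] by (simp add: pos_le_divide_eq)
    then show "t - w 1 / w (Suc n) \<le> w (cutoff t n) / w (Suc n)"
      by (simp add: add_divide_distrib)
  qed
  show "\<forall>\<^sub>F n in sequentially. w (cutoff t n) / w (Suc n) \<le> t"
    using cutoff_lower[OF assms(1)] w_Suc_pos by (intro always_eventually allI) (simp add: field_simps)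
qed

text \<open>Slow variation absorbs both the factor \<open>c\<close> and the choice of the end time.
  \<open>Lambda_lower\<close> relies on c = 1 and c = 2 having the same limit.\<close>

lemma visits_cutoff_tendsto:
  assumes N: "prob_space N" "sets N = sets M" "absolutely_continuous M N"
    and t: "0 < t" "t < 1" and c: "1 \<le> c" "c \<le> 2"
    and m: "\<forall>\<^sub>F n in sequentially. n \<le> m n \<and> m n \<le> 2 * n"
  shows "(\<lambda>n. measure N (visits (m n) (c * cutoff t n))) \<longlonglongrightarrow> t"
proof (rule visits_tendsto[OF N])
  show m_top: "filterlim m at_top sequentially"
    by (rule filterlim_at_top_mono[OF filterlim_ident]) (use m in \<open>auto elim: eventually_mono\<close>)
  show "\<forall>\<^sub>F n in sequentially. 2 * (c * cutoff t n) \<le> m n"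
    using cutoff_small[OF t] m
  proof eventually_elim
    case (elim n)
    have "c * cutoff t n \<le> 2 * cutoff t n" using c by simp
    then show ?case using elim by linarith
  qed
  have 1: "(\<lambda>n. w (m n) / w n) \<longlonglongrightarrow> 1"
    by (rule w_ratio_tendsto[OF filterlim_ident m])
  have 2: "(\<lambda>n. w (Suc n) / w n) \<longlonglongrightarrow> 1"
    by (rule w_ratio_tendsto[OF filterlim_ident, of _ 2]) (rule eventually_sequentiallyI[of 1], auto)
  have 3: "(\<lambda>n. w (c * cutoff t n) / w (cutoff t n)) \<longlonglongrightarrow> 1"
    by (rule filterlim_compose[OF w_mult_tendsto[OF c(1)] cutoff_at_top[OF t]])
  have "(\<lambda>n. w (c * cutoff t n) / w (cutoff t n) * (w (cutoff t n) / w (Suc n)) * (w (Suc n) / w n) *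
      inverse (w (m n) / w n)) \<longlonglongrightarrow> 1 * t * 1 * inverse 1"
    by (intro tendsto_intros 1 2 3 w_cutoff_tendsto[OF t]) simp
  then have "(\<lambda>n. w (c * cutoff t n) / w (cutoff t n) * (w (cutoff t n) / w (Suc n)) * (w (Suc n) / w n) *
      inverse (w (m n) / w n)) \<longlonglongrightarrow> t" by simp
  moreover have "\<forall>\<^sub>F n in sequentially. w (c * cutoff t n) / w (cutoff t n) * (w (cutoff t n) / w (Suc n)) *
      (w (Suc n) / w n) * inverse (w (m n) / w n) = w (c * cutoff t n) / w (m n)"
    using w_pos_eventually[OF cutoff_at_top[OF t]] w_pos_eventually[OF filterlim_ident]
      w_pos_eventually[OF m_top]
  proof eventually_elim
    case (elim n)
    then show ?case using w_Suc_pos[of n] by (simp add: field_simps)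
  qed
  ultimately show "(\<lambda>n. w (c * cutoff t n) / w (m n)) \<longlonglongrightarrow> t"
    by (rule Lim_transform_eventually)
qed

section \<open>The two processes in terms of visits\<close>

lemma Lambda_eq: "Lambda_proc M T A n x = w (Suc (V_proc M T A n x)) / w (Suc n)"
  by (simp add: Lambda_proc_def sum_return_tail measure_hit_set)

lemma Delta_eq: "Delta_proc M T A n x = w (Suc (Y_proc T A n x - n)) / w (Suc n)"
  by (simp add: Delta_proc_def sum_return_tail measure_hit_set)

lemma Z_le: "Z_proc M T A n x \<le> n"
proof (cases "x \<in> hit_set M T A n")
  case True
  then have "{k. k \<le> n \<and> (T ^^ k) x \<in> A} \<noteq> {}"
    by (auto simp: hit_set_def pre_iter_def)
  then have "Max {k. k \<le> n \<and> (T ^^ k) x \<in> A} \<in> {k. k \<le> n \<and> (T ^^ k) x \<in> A}"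
    by (intro Max_in) auto
  then show ?thesis using True by (simp add: Z_proc_def)
qed (simp add: Z_proc_def)

lemma Delta_le_Lambda: "Delta_proc M T A n x \<le> Lambda_proc M T A n x"
  unfolding Delta_eq Lambda_eq V_proc_def using Z_le[of n x] w_Suc_pos[of n]
  by (intro divide_right_mono w_mono) auto

lemma Delta_le_visits:
  assumes "t < 1" "x \<in> space M" "\<exists>k>n. (T ^^ k) x \<in> A" "Delta_proc M T A n x \<le> t"
  shows "x \<in> visits (n + cutoff t n) (cutoff t n)"
proof -
  have Y: "n < Y_proc T A n x" "(T ^^ Y_proc T A n x) x \<in> A"
    using LeastI_ex[of "\<lambda>k. n < k \<and> (T ^^ k) x \<in> A"] assms(3) by (auto simp: Y_proc_def)
  have "w (Suc (Y_proc T A n x - n)) \<le> t * w (Suc n)"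
    using assms(4) w_Suc_pos[of n] by (simp add: Delta_eq field_simps)
  also have "\<dots> < w (Suc (cutoff t n))" by (rule cutoff_upper[OF assms(1)])
  finally have "Y_proc T A n x - n < cutoff t n" using w_mono[of "Suc (cutoff t n)" "Suc (Y_proc T A n x - n)"]
    by (auto simp: not_less[symmetric])
  \<comment> \<open>The next visit time lies strictly between \<open>n\<close> and
    \<open>n + cutoff t n\<close>, so the witness is below the cutoff and the subtraction is
    exact.\<close>
  then show ?thesis using Y assms(2)
    by (auto simp: visits_def intro!: exI[of _ "n + cutoff t n - Y_proc T A n x"])
qed

text \<open>The next visit comes by time n + j and the last one not before n + 1 - j, so the gap is
  at most 2j - 1.\<close>

lemma visits_V_bound:
  assumes "x \<in> visits (n + j) j" "x \<in> visits n j" "j \<le> n"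
  shows "Suc (V_proc M T A n x) \<le> 2 * j"
proof -
  obtain i where i: "i < j" "(T ^^ (n + j - i)) x \<in> A" and xs: "x \<in> space M"
    using assms(1) by (auto simp: visits_def)
  obtain i' where i': "i' < j" "(T ^^ (n - i')) x \<in> A"
    using assms(2) by (auto simp: visits_def)
  have "Y_proc T A n x \<le> n + j - i"
    unfolding Y_proc_def using i by (intro Least_le) auto
  moreover have "n - i' \<le> Z_proc M T A n x"
  proof -
    have "x \<in> hit_set M T A n" using i' xs by (auto simp: hit_set_def pre_iter_def)
    then show ?thesis unfolding Z_proc_def using i' by (auto intro!: Max_ge)
  qed
  ultimately show ?thesis using i i' assms(3) by (simp add: V_proc_def)
qed

text \<open>This makes the union in the inclusion-exclusion of \<open>Lambda_lower\<close> a single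
  window, whose probability is known.\<close>

lemma visits_split: "visits (n + j) (2 * j) = visits (n + j) j \<union> visits n j"
proof -
  have "(\<exists>i<2 * j. Q (n + j - i)) \<longleftrightarrow> (\<exists>i<j. Q (n + j - i)) \<or> (\<exists>i<j. Q (n - i))" for Q
  proof safe
    fix i assume i: "i < 2 * j" "Q (n + j - i)" "\<not> (\<exists>i<j. Q (n - i))"
    show "\<exists>i<j. Q (n + j - i)"
    proof (cases "i < j")
      case False
      then have "n + j - i = n - (i - j)" "i - j < j" using i by auto
      with i show ?thesis by metis
    qed (use i in blast)
  next
    fix i assume "i < j" "Q (n + j - i)"
    then show "\<exists>i<2 * j. Q (n + j - i)" by (intro exI[of _ i]) auto
  next
    fix i assume "i < j" "Q (n - i)"
    then show "\<exists>i<2 * j. Q (n + j - i)" by (intro exI[of _ "i + j"]) auto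
  qed
  from this[of "\<lambda>k. (T ^^ k) _ \<in> A"] show ?thesis by (auto simp: visits_def)
qed

lemma Y_measurable[measurable]: "Y_proc T A n \<in> measurable M (count_space UNIV)"
  unfolding Y_proc_def by measurable

lemma Z_measurable[measurable]: "Z_proc M T A n \<in> measurable M (count_space UNIV)"
proof -
  have [measurable]: "hit_set M T A n \<in> sets M" by (simp add: hit_set_eq visits_sets)
  show ?thesis unfolding Z_proc_def by measurable
qed

lemma V_measurable[measurable]: "V_proc M T A n \<in> measurable M (count_space UNIV)"
  unfolding V_proc_def by measurable

lemma Lambda_measurable[measurable]: "Lambda_proc M T A n \<in> borel_measurable M"
  unfolding Lambda_eq[abs_def] by measurable

lemma Delta_measurable[measurable]: "Delta_proc M T A n \<in> borel_measurable M"
  unfolding Delta_eq[abs_def] by measurable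

lemma Delta_upper:
  assumes N: "prob_space N" "sets N = sets M" "absolutely_continuous M N"
    and t: "0 < t" "t < 1" and a: "t < a"
  shows "\<forall>\<^sub>F n in sequentially. measure N {x \<in> space M. Delta_proc M T A n x \<le> t} < a"
proof -
  interpret N: prob_space N by fact
  note [measurable_cong] = N(2)
  have "(\<lambda>n. measure N (visits (n + cutoff t n) (1 * cutoff t n))) \<longlonglongrightarrow> t"
  proof (rule visits_cutoff_tendsto[OF N t])
    show "\<forall>\<^sub>F n in sequentially. n \<le> n + cutoff t n \<and> n + cutoff t n \<le> 2 * n"
      using cutoff_small[OF t] by eventually_elim simp
  qed auto
  then have "\<forall>\<^sub>F n in sequentially. measure N (visits (n + cutoff t n) (1 * cutoff t n)) < a"
    using a by (intro order_tendstoD) auto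
  then show ?thesis
  proof eventually_elim
    case (elim n)
    \<comment> \<open>\<open>Y_proc\<close> is meaningful only if a later visit exists, which
      recurrence grants almost everywhere; hence an inclusion up to a null set.\<close>
    have "AE x in M. x \<in> {x \<in> space M. Delta_proc M T A n x \<le> t} \<longrightarrow> x \<in> visits (n + cutoff t n) (cutoff t n)"
      using AE_visits
    proof eventually_elim
      case (elim x)
      then have "\<exists>k>n. (T ^^ k) x \<in> A" by (meson Suc_le_eq)
      then show ?case using Delta_le_visits[OF t(2)] by blast
    qed
    then have "AE x in N. x \<in> {x \<in> space M. Delta_proc M T A n x \<le> t} \<longrightarrow> x \<in> visits (n + cutoff t n) (cutoff t n)"
      using absolutely_continuous_AE[OF N(2,3)] by blast
    then have "measure N {x \<in> space M. Delta_proc M T A n x \<le> t} \<le> measure N (visits (n + cutoff t n) (cutoff t n))"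
      by (intro N.finite_measure_mono_AE) (auto simp: N(2) visits_sets)
    then show ?case using elim by simp
  qed
qed

text \<open>Visits on both sides of n within \<open>cutoff s n\<close> force a gap below twice that
  cutoff. Their joint probability tends to s + s - s, because the union is a window of twice the
  length with the same limit.\<close>

lemma Lambda_lower:
  assumes N: "prob_space N" "sets N = sets M" "absolutely_continuous M N"
    and t: "0 < t" "t < 1" and a: "a < t"
  shows "\<forall>\<^sub>F n in sequentially. a < measure N {x \<in> space M. Lambda_proc M T A n x \<le> t}"
proof -
  interpret N: prob_space N by fact
  note [measurable_cong] = N(2)
  \<comment> \<open>A level strictly below \<open>t\<close> leaves room for the ratio
    \<open>w (2 * cutoff s n) / w (Suc n)\<close>, which only tends to \<open>s\<close>; the maximum
    with 0 keeps \<open>s\<close> positive.\<close>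
  obtain s where "max 0 a < s" "s < t" using dense[of "max 0 a" t] a t by auto
  then have s: "0 < s" "s < 1" "a < s" "s < t" using t by auto
  have m: "\<forall>\<^sub>F n in sequentially. n \<le> n + cutoff s n \<and> n + cutoff s n \<le> 2 * n"
    using cutoff_small[OF s(1,2)] by eventually_elim simp
  have m': "\<forall>\<^sub>F n in sequentially. n \<le> n \<and> n \<le> 2 * n" by simp
  have "(\<lambda>n. measure N (visits (n + cutoff s n) (1 * cutoff s n)) + measure N (visits n (1 * cutoff s n)) -
      measure N (visits (n + cutoff s n) (2 * cutoff s n))) \<longlonglongrightarrow> s + s - s"
    by (intro tendsto_diff tendsto_add visits_cutoff_tendsto[OF N s(1,2)] m m') auto
  then have "\<forall>\<^sub>F n in sequentially. a < measure N (visits (n + cutoff s n) (1 * cutoff s n)) +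
      measure N (visits n (1 * cutoff s n)) - measure N (visits (n + cutoff s n) (2 * cutoff s n))"
    using s by (intro order_tendstoD) auto
  moreover have "\<forall>\<^sub>F n in sequentially. w (2 * cutoff s n) / w (Suc n) < t"
  proof -
    have "(\<lambda>n. w (2 * cutoff s n) / w (cutoff s n) * (w (cutoff s n) / w (Suc n))) \<longlonglongrightarrow> 1 * s"
      by (intro tendsto_mult w_cutoff_tendsto[OF s(1,2)] filterlim_compose[OF w_mult_tendsto cutoff_at_top[OF s(1,2)]]) simp
    then have "\<forall>\<^sub>F n in sequentially. w (2 * cutoff s n) / w (cutoff s n) * (w (cutoff s n) / w (Suc n)) < t"
      using s by (intro order_tendstoD) auto
    then show ?thesis
      using w_pos_eventually[OF cutoff_at_top[OF s(1,2)]] by eventually_elim simp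
  qed
  ultimately show ?thesis using cutoff_small[OF s(1,2)]
  proof eventually_elim
    case (elim n)
    let ?E = "visits (n + cutoff s n) (cutoff s n)" and ?F = "visits n (cutoff s n)"
    have "?E \<inter> ?F \<subseteq> {x \<in> space M. Lambda_proc M T A n x \<le> t}"
    proof
      fix x assume x: "x \<in> ?E \<inter> ?F"
      then have "w (Suc (V_proc M T A n x)) \<le> w (2 * cutoff s n)"
        using elim(3) by (intro w_mono visits_V_bound) auto
      then have "Lambda_proc M T A n x \<le> w (2 * cutoff s n) / w (Suc n)"
        unfolding Lambda_eq using w_Suc_pos[of n] by (intro divide_right_mono) auto
      then show "x \<in> {x \<in> space M. Lambda_proc M T A n x \<le> t}"
        using elim(2) x by (auto simp: visits_def)
    qed
    then have "measure N (?E \<inter> ?F) \<le> measure N {x \<in> space M. Lambda_proc M T A n x \<le> t}"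
      by (intro N.finite_measure_mono) (auto simp: N(2))
    moreover have "measure N (?E \<union> ?F) = measure N ?E + measure N ?F - measure N (?E \<inter> ?F)"
      using N.finite_measure_Union'[of ?E ?F] N.finite_measure_Diff'[of ?F ?E]
      by (simp add: N(2) visits_sets Int_commute)
    ultimately show ?case using elim(1) by (simp add: visits_split)
  qed
qed

text \<open>Since Delta is at most Lambda, its distribution function is the larger one, so the upper
  bound for Delta and the lower bound for Lambda serve both.\<close>

lemma distr_tendsto:
  assumes N: "prob_space N" "sets N = sets M" "absolutely_continuous M N"
    and t: "0 < t" "t < 1"
  shows "(\<lambda>n. measure N {x \<in> space M. Lambda_proc M T A n x \<le> t}) \<longlonglongrightarrow> t"
    "(\<lambda>n. measure N {x \<in> space M. Delta_proc M T A n x \<le> t}) \<longlonglongrightarrow> t"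
proof -
  interpret N: prob_space N by fact
  note [measurable_cong] = N(2)
  have le: "measure N {x \<in> space M. Lambda_proc M T A n x \<le> t} \<le>
      measure N {x \<in> space M. Delta_proc M T A n x \<le> t}" for n
    using Delta_le_Lambda
    by (intro N.finite_measure_mono) (auto simp: N(2) intro: order_trans)
  have up: "\<forall>\<^sub>F n in sequentially. measure N {x \<in> space M. Lambda_proc M T A n x \<le> t} < a" if "t < a" for a
    using Delta_upper[OF N t that] by eventually_elim (rule le_less_trans[OF le])
  have low: "\<forall>\<^sub>F n in sequentially. a < measure N {x \<in> space M. Delta_proc M T A n x \<le> t}" if "a < t" for a
    using Lambda_lower[OF N t that] by eventually_elim (rule less_le_trans[OF _ le])
  show "(\<lambda>n. measure N {x \<in> space M. Lambda_proc M T A n x \<le> t}) \<longlonglongrightarrow> t"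
    by (rule order_tendstoI[OF Lambda_lower[OF N t] up])
  show "(\<lambda>n. measure N {x \<in> space M. Delta_proc M T A n x \<le> t}) \<longlonglongrightarrow> t"
    by (rule order_tendstoI[OF low Delta_upper[OF N t]])
qed

end

section \<open>The uniform law as a weak limit\<close>

lemma cdf_uniform01:
  "cdf (uniform_measure lborel {0..1}) x = (if x \<le> 0 then 0 else if x \<le> 1 then x else 1)"
proof -
  have "cdf (uniform_measure lborel {0..1}) x = measure lborel ({0..1} \<inter> {..x})"
    by (simp add: cdf_def)
  also have "{0..1} \<inter> {..x} = {0..min 1 x}" by auto
  also have "measure lborel {0..min 1 x} = (if x \<le> 0 then 0 else if x \<le> 1 then x else 1)"
    by (simp add: min_def)
  finally show ?thesis .
qed

text \<open>Distribution functions are monotone with values in [0,1], so the limits at levels close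
  to 0 and 1 settle those outside the open interval.\<close>

lemma weak_conv_uniform01:
  assumes "prob_space N" and R[measurable]: "\<And>n. R n \<in> borel_measurable N"
    and lim: "\<And>t. 0 < t \<Longrightarrow> t < 1 \<Longrightarrow> (\<lambda>n. measure N {x \<in> space N. R n x \<le> t}) \<longlonglongrightarrow> t"
  shows "weak_conv_m (\<lambda>n. distr N borel (R n)) (uniform_measure lborel {0..1})"
proof -
  interpret N: prob_space N by fact
  have cdf: "cdf (distr N borel (R n)) x = measure N {y \<in> space N. R n y \<le> x}" for n x
    by (auto simp: cdf_def measure_distr intro!: arg_cong[where f = "measure N"])
  have mono: "measure N {y \<in> space N. R n y \<le> x} \<le> measure N {y \<in> space N. R n y \<le> x'}"
    if "x \<le> x'" for n x x'
    using that by (intro N.finite_measure_mono) auto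
  have "(\<lambda>n. measure N {y \<in> space N. R n y \<le> x}) \<longlonglongrightarrow> cdf (uniform_measure lborel {0..1}) x" for x
  proof -
    consider "x \<le> 0" | "0 < x" "x < 1" | "1 \<le> x" by linarith
    then show ?thesis
    proof cases
      case 1
      have "(\<lambda>n. measure N {y \<in> space N. R n y \<le> x}) \<longlonglongrightarrow> 0"
      proof (rule order_tendstoI)
        fix a :: real assume "0 < a"
        define t where "t = min (a / 2) (1 / 2)"
        have t: "0 < t" "t < 1" "t < a" using \<open>0 < a\<close> by (auto simp: t_def)
        have "\<forall>\<^sub>F n in sequentially. measure N {y \<in> space N. R n y \<le> t} < a"
          using lim[OF t(1,2)] t(3) by (intro order_tendstoD) auto
        then show "\<forall>\<^sub>F n in sequentially. measure N {y \<in> space N. R n y \<le> x} < a"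
          by eventually_elim (use 1 t mono[of x t] in \<open>auto intro: le_less_trans\<close>)
      next
        fix a :: real assume "a < 0"
        then show "\<forall>\<^sub>F n in sequentially. a < measure N {y \<in> space N. R n y \<le> x}"
          by (intro always_eventually allI) (auto intro: less_le_trans)
      qed
      then show ?thesis using 1 by (simp add: cdf_uniform01)
    next
      case 2
      then show ?thesis using lim[OF 2] by (simp add: cdf_uniform01)
    next
      case 3
      have "(\<lambda>n. measure N {y \<in> space N. R n y \<le> x}) \<longlonglongrightarrow> 1"
      proof (rule order_tendstoI)
        fix a :: real assume "a < 1"
        define t where "t = max ((1 + a) / 2) (1 / 2)"
        have t: "0 < t" "t < 1" "a < t" using \<open>a < 1\<close> by (auto simp: t_def max_def)
        have "\<forall>\<^sub>F n in sequentially. a < measure N {y \<in> space N. R n y \<le> t}"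
          using lim[OF t(1,2)] t(3) by (intro order_tendstoD) auto
        then show "\<forall>\<^sub>F n in sequentially. a < measure N {y \<in> space N. R n y \<le> x}"
          by eventually_elim (use 3 t mono[of t x] in \<open>auto intro: less_le_trans\<close>)
      next
        fix a :: real assume "1 < a"
        then show "\<forall>\<^sub>F n in sequentially. measure N {y \<in> space N. R n y \<le> x} < a"
          by (intro always_eventually allI) (auto intro: le_less_trans)
      qed
      then show ?thesis using 3 by (cases "x = 1") (simp_all add: cdf_uniform01)
    qed
  qed
  then show ?thesis by (simp add: weak_conv_m_def weak_conv_def cdf)
qed

section \<open>Transfer operator and return probabilities\<close>

lemma transfer_op_funpow:
  assumes "sigma_finite_measure M" and mp: "measure_preserving M T" and f: "integrable M f"
  shows "integrable M ((transfer_op M T ^^ n) f)"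
    "B \<in> sets M \<Longrightarrow> set_lebesgue_integral M B ((transfer_op M T ^^ n) f) =
      set_lebesgue_integral M (pre_iter M T n B) f"
proof (induction n arbitrary: B)
  case 0
  { case 1 then show ?case using f by simp }
  { case 2 then show ?case using sets.sets_into_space by (simp add: pre_iter_def Int_absorb2) }
next
  case (Suc n)
  have tr: "is_transfer M T ((transfer_op M T ^^ n) f) ((transfer_op M T ^^ Suc n) f)"
    using is_transfer_transfer_op[OF assms(1) mp Suc(1)] by simp
  { case 1 then show ?case using tr by (simp add: is_transfer_def) }
  { case (2 B)
    have T: "T \<in> measurable M M" using mp by (simp add: measure_preserving_def)
    have "pre_iter M T n (T -` B \<inter> space M) = pre_iter M T (Suc n) B"
      using measurable_space[OF measurable_compose_n[OF T]] by (auto simp: pre_iter_def)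
    then show ?case using tr Suc(2)[OF measurable_sets[OF T 2]] 2
      by (simp add: is_transfer_def) }
qed

text \<open>The integral of the k-th transfer iterate over \<open>B\<close> is the probability of
  \<open>pre_iter M T k B\<close>. Integrating the uniform estimate over \<open>B\<close> therefore
  gives an error relative to \<open>measure M B\<close>, as \<open>returning\<close>
  requires.\<close>

lemma uniformly_returning_imp_visit_bounds:
  assumes sf: "sigma_finite_measure M" and mp: "measure_preserving M T"
    and ur: "uniformly_returning_for M T A f"
  defines "\<nu> \<equiv> density M (\<lambda>x. ennreal (f x))"
  shows "prob_space \<nu>" "absolutely_continuous M \<nu>"
    "\<exists>b :: nat \<Rightarrow> real. (\<forall>n. 0 < b n) \<and> incseq b \<and>
      (\<forall>e>0. \<exists>K. \<forall>k\<ge>K. \<forall>B\<in>sets M. B \<subseteq> A \<longrightarrow>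
        \<bar>b k * measure \<nu> (pre_iter M T k B) - measure M B\<bar> \<le> e * measure M B)"
proof -
  have A: "A \<in> sets M" "emeasure M A < \<infinity>" and f: "integrable M f" "AE x in M. 0 \<le> f x"
    "(\<integral>x. f x \<partial>M) = 1"
    using ur by (auto simp: uniformly_returning_for_def ac_prob_densities_def)
  have [measurable]: "f \<in> borel_measurable M" using f by auto
  have T: "T \<in> measurable M M" using mp by (simp add: measure_preserving_def)
  obtain b :: "nat \<Rightarrow> real" and N where b: "\<And>n. 0 < b n" "incseq b" and N: "N \<in> null_sets M"
    and lim: "uniform_limit (A - N) (\<lambda>n x. b n * (transfer_op M T ^^ n) f x) (\<lambda>_. 1) sequentially"
    using ur by (auto simp: uniformly_returning_for_def AE_uniform_limit_on_def)
  have em: "emeasure \<nu> C = ennreal (set_lebesgue_integral M C f)" if C[measurable]: "C \<in> sets M" for C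
  proof -
    have "emeasure \<nu> C = (\<integral>\<^sup>+x. ennreal (indicator C x * f x) \<partial>M)"
      unfolding \<nu>_def by (subst emeasure_density) (auto intro!: nn_integral_cong split: split_indicator)
    also have "\<dots> = ennreal (\<integral>x. indicator C x * f x \<partial>M)"
      using f(2) integrable_mult_indicator[OF C f(1)]
      by (intro nn_integral_eq_integral) (auto split: split_indicator elim!: eventually_mono)
    finally show ?thesis by (simp add: set_lebesgue_integral_def)
  qed
  have meas: "measure \<nu> C = set_lebesgue_integral M C f" if C: "C \<in> sets M" for C
  proof -
    have "0 \<le> set_lebesgue_integral M C f"
      unfolding set_lebesgue_integral_def using f(2)
      by (intro integral_nonneg_AE) (auto elim!: eventually_mono split: split_indicator)
    then show ?thesis using em[OF C] by (simp add: measure_def)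
  qed
  show "prob_space \<nu>"
  proof
    have "set_lebesgue_integral M (space M) f = 1"
      using f(3) by (simp add: set_integral_space f(1))
    then show "emeasure \<nu> (space \<nu>) = 1" using em[of "space M"] by (simp add: \<nu>_def)
  qed
  show "absolutely_continuous M \<nu>"
    unfolding \<nu>_def by (rule absolutely_continuousI_density) auto
  have "\<exists>K. \<forall>k\<ge>K. \<forall>B\<in>sets M. B \<subseteq> A \<longrightarrow>
        \<bar>b k * measure \<nu> (pre_iter M T k B) - measure M B\<bar> \<le> e * measure M B" if "0 < e" for e
  proof -
    obtain K where K: "\<And>k x. K \<le> k \<Longrightarrow> x \<in> A - N \<Longrightarrow> \<bar>b k * (transfer_op M T ^^ k) f x - 1\<bar> < e"
      using uniform_limitD[OF lim \<open>0 < e\<close>] by (auto simp: eventually_sequentially dist_real_def)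
    have "\<bar>b k * measure \<nu> (pre_iter M T k B) - measure M B\<bar> \<le> e * measure M B"
      if "K \<le> k" and B[measurable]: "B \<in> sets M" and BA: "B \<subseteq> A" for k B
    proof -
      define F where "F = (transfer_op M T ^^ k) f"
      have F: "integrable M F" "set_lebesgue_integral M B F = measure \<nu> (pre_iter M T k B)"
        using transfer_op_funpow[where n = k, OF sf mp f(1)] B meas[OF measurable_pre_iter[OF T B]]
        by (auto simp: F_def)
      have "B \<in> fmeasurable M"
        using A BA B by (intro fmeasurableI2[of A M B]) (auto intro: fmeasurableI)
      then have iB: "integrable M (indicator B :: _ \<Rightarrow> real)"
        by (auto simp: fmeasurable_def)
      have iF: "integrable M (\<lambda>x. indicator B x * F x)"
        using integrable_mult_indicator[OF B F(1)] by simp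
      have "b k * measure \<nu> (pre_iter M T k B) - measure M B =
          (\<integral>x. b k * (indicator B x * F x) - indicator B x \<partial>M)"
        using iB iF F(2) sets.sets_into_space[OF B]
        by (simp add: set_lebesgue_integral_def Int_absorb2)
      also have "\<bar>\<dots>\<bar> \<le> (\<integral>x. \<bar>b k * (indicator B x * F x) - indicator B x\<bar> \<partial>M)"
        by (rule integral_abs_bound)
      also have "\<dots> \<le> (\<integral>x. e * indicator B x \<partial>M)"
      proof (rule integral_mono_AE)
        show "AE x in M. \<bar>b k * (indicator B x * F x) - indicator B x\<bar> \<le> e * indicator B x"
          using AE_not_in[OF N]
        proof eventually_elim
          case (elim x)
          then show ?case using K[OF \<open>K \<le> k\<close>, of x] BA \<open>0 < e\<close>
            by (auto simp: F_def split: split_indicator)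
        qed
      qed (use iB iF in auto)
      also have "\<dots> = e * measure M B" using sets.sets_into_space[OF B] by (simp add: Int_absorb2)
      finally show ?thesis .
    qed
    then show ?thesis by blast
  qed
  then show "\<exists>b :: nat \<Rightarrow> real. (\<forall>n. 0 < b n) \<and> incseq b \<and>
      (\<forall>e>0. \<exists>K. \<forall>k\<ge>K. \<forall>B\<in>sets M. B \<subseteq> A \<longrightarrow>
        \<bar>b k * measure \<nu> (pre_iter M T k B) - measure M B\<bar> \<le> e * measure M B)"
    using b by blast
qed

theorem theorem2p4:
  fixes M :: "'a measure" and T :: "'a \<Rightarrow> 'a" and A :: "'a set"
  assumes "sigma_finite_measure M"
    and "emeasure M (space M) = \<infinity>"
    and "measure_preserving M T"
    and "conservative M T"
    and "ergodic M T"
    and "A \<in> sets M"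
    and "0 < emeasure M A"
    and "emeasure M A < \<infinity>"
    and "uniformly_returning M T A"
    and "slowly_varying_seq (wandering_rate M T A)"
  shows "strong_dist_conv M (Lambda_proc M T A) (uniform_measure lborel {0..1}) \<and>
         strong_dist_conv M (Delta_proc M T A) (uniform_measure lborel {0..1})"
proof -
  obtain f where f: "uniformly_returning_for M T A f"
    using assms(9) by (auto simp: uniformly_returning_def)
  note ur = uniformly_returning_imp_visit_bounds[OF assms(1,3) f]
  obtain b :: "nat \<Rightarrow> real" where b: "\<And>n. 0 < b n" "incseq b"
    "\<And>e. 0 < e \<Longrightarrow> \<exists>K. \<forall>k\<ge>K. \<forall>B\<in>sets M. B \<subseteq> A \<longrightarrow>
      \<bar>b k * measure (density M (\<lambda>x. ennreal (f x))) (pre_iter M T k B) - measure M B\<bar> \<le> e * measure M B"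
    using ur(3) by blast
  interpret sigma_finite_measure M by fact
  interpret slow_returning M T A "density M (\<lambda>x. ennreal (f x))" b
    by (intro slow_returning.intro recurrent_system.intro recurrent_system_axioms.intro slow_returning_axioms.intro
        assms ur(1,2) b sets_density)
  have "weak_conv_m (\<lambda>n. distr N borel (Lambda_proc M T A n)) (uniform_measure lborel {0..1})"
    "weak_conv_m (\<lambda>n. distr N borel (Delta_proc M T A n)) (uniform_measure lborel {0..1})"
    if "N \<in> ac_prob_measures M" for N
  proof -
    have N: "prob_space N" "sets N = sets M" "absolutely_continuous M N"
      using that by (auto simp: ac_prob_measures_def)
    have sp: "space N = space M" using N(2) by (rule sets_eq_imp_space_eq)
    note [measurable_cong] = N(2)
    show "weak_conv_m (\<lambda>n. distr N borel (Lambda_proc M T A n)) (uniform_measure lborel {0..1})"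
      by (rule weak_conv_uniform01[OF N(1)]) (use distr_tendsto(1)[OF N] in \<open>simp_all add: sp\<close>)
    show "weak_conv_m (\<lambda>n. distr N borel (Delta_proc M T A n)) (uniform_measure lborel {0..1})"
      by (rule weak_conv_uniform01[OF N(1)]) (use distr_tendsto(2)[OF N] in \<open>simp_all add: sp\<close>)
  qed
  then show ?thesis by (simp add: strong_dist_conv_def)
qed

end
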